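(* Let $\mathcal I$ be the Iwasawa manifold. The product complex manifold $M=\mathcal I\times\mathbb C$ admits a non-invariant balanced metric of Hodge-Riemann type.
   Context: The Iwasawa manifold is $\mathcal I=\Gamma\backslash H$, where $H=\mathrm{Heis}(3,\mathbb C)$ is the complex Lie group of upper triangular $3\times3$ complex matrices with ones on the diagonal, and $\Gamma=\mathrm{Heis}(3,\mathbb Z[i])$ is the subgroup of matrices with Gaussian integer entries; $\mathcal I$ carries the complex structure induced by that of $H$. $M$ carries the product complex structure. A metric on $M$ is invariant if it is induced by a left-invariant metric on the Lie group $H\times\mathbb C$, and non-invariant otherwise. On a complex manifold of complex dimension $n\ge 3$ (here $n=4$), $\Lambda^{p,q}$ denotes $(p,q)$-forms; Hermitian metrics are identified with their fundamental (positive) $(1,1)$-forms; a Hermitian metric $F$ is balanced if $dF^{n-1}=0$. For a real $(n-2,n-2)$-form $\Omega$ and $p+q=2$, let $Q_\Omega^{p,q}(\alpha,\beta)=-\,i^{p-q}\star(\alpha\wedge\bar\beta\wedge\Omega)$ for $\alpha,\beta\in\Lambda^{p,q}$ (pointwise), where $\star$ is the Hodge star of a fixed auxiliary Hermitian metric. Given a Hermitian metric $\omega$, put $P^{p,q}=\{\alpha\in\Lambda^{p,q}:\alpha\wedge\omega\wedge\Omega=0\}$. $\Omega$ is a Hodge-Riemann form with respect to $\omega$ for degree $(p,q)$ if, at every point, $Q_\Omega^{p,q}$ is positive definite on $P^{p,q}$ and there is a $Q_\Omega^{p,q}$-orthogonal decomposition $\Lambda^{p,q}=\omega\wedge\Lambda^{p-1,q-1}\oplus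 P^{p,q}$ (with $\Lambda^{p-1,q-1}=0$ if $pq=0$). A balanced metric $F$ is of Hodge-Riemann type if there exist a Hermitian metric $\omega$ and a real $(n-2,n-2)$-form $\Omega$ such that $\frac{F^{n-1}}{(n-1)!}=\omega\wedge\Omega$, $\Omega$ is a Hodge-Riemann form with respect to $\omega$ for all degrees $(p,q)$ with $p+q=2$, and $\Omega$ and $\omega\wedge\Omega$ are closed. *)

theory Defs
  imports "HOL-Analysis.Analysis"
begin

text \<open>
  An element of the complexified exterior algebra of the cotangent space is given by its
  coefficients: \<open>\<alpha> I J\<close> is the coefficient of \<open>dz_I \<and> dzbar_J\<close>, where the factors of
  \<open>dz_I\<close> and \<open>dzbar_J\<close> are taken in increasing order of the indices.
\<close>

type_synonym 'n covec = "'n set \<Rightarrow> 'n set \<Rightarrow> complex"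
type_synonym 'n cspace = "complex ^ 'n"
type_synonym 'n cform = "'n cspace \<Rightarrow> 'n covec"

definition czero :: "'n covec" where
  "czero = (\<lambda>I J. 0)"

definition cone :: "'n covec" where
  "cone = (\<lambda>I J. if I = {} \<and> J = {} then 1 else 0)"

definition cadd :: "'n covec \<Rightarrow> 'n covec \<Rightarrow> 'n covec" where
  "cadd \<alpha> \<beta> = (\<lambda>I J. \<alpha> I J + \<beta> I J)"

definition cscale :: "complex \<Rightarrow> 'n covec \<Rightarrow> 'n covec" where
  "cscale c \<alpha> = (\<lambda>I J. c * \<alpha> I J)"

definition dz :: "'n \<Rightarrow> 'n covec" where
  "dz j = (\<lambda>I J. if I = {j} \<and> J = {} then 1 else 0)"

definition dzbar :: "'n \<Rightarrow> 'n covec" where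
  "dzbar j = (\<lambda>I J. if I = {} \<and> J = {j} then 1 else 0)"

text \<open>
  For disjoint \<open>A\<close>, \<open>B\<close> we have \<open>dz_A \<and> dz_B = shuffle_sign A B \<cdot> dz_(A \<union> B)\<close>. In
  \<open>(dz_A \<and> dzbar_B) \<and> (dz_A' \<and> dzbar_B')\<close>, moving \<open>dz_A'\<close> past \<open>dzbar_B\<close> contributes
  the further sign \<open>(-1)^(|B| |A'|)\<close>.
\<close>

definition shuffle_sign :: "'n::linorder set \<Rightarrow> 'n set \<Rightarrow> complex" where
  "shuffle_sign A B = (-1) ^ card {(a, b). a \<in> A \<and> b \<in> B \<and> b < a}"

definition wedge :: "'n::{finite,linorder} covec \<Rightarrow> 'n covec \<Rightarrow> 'n covec" where
  "wedge \<alpha> \<beta> = (\<lambda>I J. \<Sum>A\<in>Pow I. \<Sum>B\<in>Pow J.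
     (-1) ^ (card B * card (I - A)) * shuffle_sign A (I - A) * shuffle_sign B (J - B)
       * \<alpha> A B * \<beta> (I - A) (J - B))"

definition wedge_list :: "'n::{finite,linorder} covec list \<Rightarrow> 'n covec" where
  "wedge_list \<alpha>s = foldr wedge \<alpha>s cone"

definition wedge_power :: "'n::{finite,linorder} covec \<Rightarrow> nat \<Rightarrow> 'n covec" where
  "wedge_power \<alpha> k = wedge_list (replicate k \<alpha>)"

text \<open>The sign comes from \<open>dzbar_I \<and> dz_J = (-1)^(|I| |J|) dz_J \<and> dzbar_I\<close>.\<close>

definition conj_covec :: "'n covec \<Rightarrow> 'n covec" where
  "conj_covec \<alpha> = (\<lambda>I J. (-1) ^ (card I * card J) * cnj (\<alpha> J I))"

definition Lam :: "nat \<Rightarrow> nat \<Rightarrow> 'n covec set" where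
  "Lam p q = {\<alpha>. \<forall>I J. \<alpha> I J \<noteq> 0 \<longrightarrow> card I = p \<and> card J = q}"

definition has_type :: "nat \<Rightarrow> nat \<Rightarrow> 'n::finite cform \<Rightarrow> bool" where
  "has_type p q \<alpha> \<longleftrightarrow> (\<forall>x. \<alpha> x \<in> Lam p q)"

definition real_form :: "'n::finite cform \<Rightarrow> bool" where
  "real_form \<alpha> \<longleftrightarrow> (\<forall>x. conj_covec (\<alpha> x) = \<alpha> x)"

text \<open>On a finite-dimensional domain this is \<open>C^k\<close> in the real sense.\<close>

primrec Ck :: "nat \<Rightarrow> ('a::real_normed_vector \<Rightarrow> 'b::real_normed_vector) \<Rightarrow> bool" where
  "Ck 0 f \<longleftrightarrow> continuous_on UNIV f"
| "Ck (Suc k) f \<longleftrightarrow> (\<forall>x. f differentiable (at x)) \<and>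
     (\<forall>v. Ck k (\<lambda>x. frechet_derivative f (at x) v))"

definition smooth_form :: "'n::finite cform \<Rightarrow> bool" where
  "smooth_form \<alpha> \<longleftrightarrow> (\<forall>I J k. Ck k (\<lambda>x. \<alpha> x I J))"

definition pdz :: "'n::finite \<Rightarrow> ('n cspace \<Rightarrow> complex) \<Rightarrow> 'n cspace \<Rightarrow> complex" where
  "pdz j f x = (frechet_derivative f (at x) (axis j 1)
                - \<i> * frechet_derivative f (at x) (axis j \<i>)) / 2"

definition pdzbar :: "'n::finite \<Rightarrow> ('n cspace \<Rightarrow> complex) \<Rightarrow> 'n cspace \<Rightarrow> complex" where
  "pdzbar j f x = (frechet_derivative f (at x) (axis j 1)
                   + \<i> * frechet_derivative f (at x) (axis j \<i>)) / 2"

definition ext_deriv :: "'n::{finite,linorder} cform \<Rightarrow> 'n cform" where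
  "ext_deriv \<alpha> x = (\<lambda>I J. \<Sum>j\<in>UNIV.
      wedge (dz j) (\<lambda>K L. pdz j (\<lambda>y. \<alpha> y K L) x) I J
    + wedge (dzbar j) (\<lambda>K L. pdzbar j (\<lambda>y. \<alpha> y K L) x) I J)"

definition closed_form :: "'n::{finite,linorder} cform \<Rightarrow> bool" where
  "closed_form \<alpha> \<longleftrightarrow> (\<forall>x. ext_deriv \<alpha> x = czero)"

definition function_form :: "('n::finite cspace \<Rightarrow> complex) \<Rightarrow> 'n cform" where
  "function_form f x = cscale (f x) cone"

definition pullback ::
    "('n::{finite,linorder} cspace \<Rightarrow> 'n cspace) \<Rightarrow> 'n cform \<Rightarrow> 'n cform" where
  "pullback f \<alpha> x = (\<lambda>K L. \<Sum>I\<in>UNIV. \<Sum>J\<in>UNIV. \<alpha> (f x) I J *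
     wedge_list
       (map (\<lambda>i. ext_deriv (function_form (\<lambda>y. f y $ i)) x) (sorted_list_of_set I) @
        map (\<lambda>j. ext_deriv (function_form (\<lambda>y. cnj (f y $ j))) x) (sorted_list_of_set J)) K L)"

text \<open>
  Let \<open>G\<close> be a group of biholomorphisms of \<open>\<complex>\<^sup>n\<close> acting freely and properly
  discontinuously. The local inverses of the covering \<open>\<complex>\<^sup>n \<rightarrow> G\<bsol>\<complex>\<^sup>n\<close> form a holomorphic
  atlas of the quotient whose transition maps are restrictions of elements of \<open>G\<close>. A form
  on the quotient is a family of forms in these charts compatible with the transition maps,
  that is, a \<open>G\<close>-invariant form on \<open>\<complex>\<^sup>n\<close>. Wedge products, types, \<open>d\<close> and all pointwise
  conditions are computed in these charts.
\<close>

definition form_on :: "('n::{finite,linorder} cspace \<Rightarrow> 'n cspace) set \<Rightarrow> 'n cform \<Rightarrow> bool" where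
  "form_on G \<alpha> \<longleftrightarrow> smooth_form \<alpha> \<and> (\<forall>\<gamma>\<in>G. pullback \<gamma> \<alpha> = \<alpha>)"

text \<open>That is, \<open>F = i \<Sum> h_jk dz_j \<and> dzbar_k\<close> with \<open>(h_jk)\<close> positive definite.\<close>

definition positive_11 :: "'n::finite cform \<Rightarrow> bool" where
  "positive_11 F \<longleftrightarrow> (\<forall>x. \<forall>v. v \<noteq> 0 \<longrightarrow>
     0 < Re (\<Sum>j\<in>UNIV. \<Sum>k\<in>UNIV. - \<i> * F x {j} {k} * v $ j * cnj (v $ k)))"

definition hermitian_metric_on ::
    "('n::{finite,linorder} cspace \<Rightarrow> 'n cspace) set \<Rightarrow> 'n cform \<Rightarrow> bool" where
  "hermitian_metric_on G F \<longleftrightarrow>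
     form_on G F \<and> has_type 1 1 F \<and> real_form F \<and> positive_11 F"

definition balanced_metric_on ::
    "('n::{finite,linorder} cspace \<Rightarrow> 'n cspace) set \<Rightarrow> 'n cform \<Rightarrow> bool" where
  "balanced_metric_on G F \<longleftrightarrow>
     hermitian_metric_on G F \<and> closed_form (\<lambda>x. wedge_power (F x) (CARD('n) - 1))"

text \<open>
  The Hodge star enters only on forms of top degree, where it is determined by
  \<open>\<star>(c \<cdot> vol) = c\<close>, with \<open>vol = g^n / n!\<close> the volume form of the metric with
  fundamental form \<open>g\<close>.
\<close>

definition volume :: "'n::{finite,linorder} covec \<Rightarrow> 'n covec" where
  "volume g = cscale (1 / fact CARD('n)) (wedge_power g CARD('n))"

definition star_top :: "'n::{finite,linorder} covec \<Rightarrow> 'n covec \<Rightarrow> complex" where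
  "star_top g \<tau> = \<tau> UNIV UNIV / volume g UNIV UNIV"

definition HR_form ::
    "'n::{finite,linorder} covec \<Rightarrow> 'n covec \<Rightarrow> nat \<Rightarrow> nat \<Rightarrow> 'n covec \<Rightarrow> 'n covec \<Rightarrow> complex" where
  "HR_form g \<Omega> p q \<alpha> \<beta> =
     - (\<i> powi (int p - int q)) * star_top g (wedge (wedge \<alpha> (conj_covec \<beta>)) \<Omega>)"

definition primitive ::
    "'n::{finite,linorder} covec \<Rightarrow> 'n covec \<Rightarrow> nat \<Rightarrow> nat \<Rightarrow> 'n covec set" where
  "primitive \<omega> \<Omega> p q = {\<alpha> \<in> Lam p q. wedge (wedge \<alpha> \<omega>) \<Omega> = czero}"

definition lefschetz_image ::
    "'n::{finite,linorder} covec \<Rightarrow> nat \<Rightarrow> nat \<Rightarrow> 'n covec set" where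
  "lefschetz_image \<omega> p q =
     (if p = 0 \<or> q = 0 then {czero} else wedge \<omega> ` Lam (p - 1) (q - 1))"

definition hodge_riemann_at ::
    "'n::{finite,linorder} covec \<Rightarrow> 'n covec \<Rightarrow> 'n covec \<Rightarrow> nat \<Rightarrow> nat \<Rightarrow> bool" where
  "hodge_riemann_at g \<omega> \<Omega> p q \<longleftrightarrow>
     (\<forall>\<alpha>\<in>primitive \<omega> \<Omega> p q. \<alpha> \<noteq> czero \<longrightarrow>
        Im (HR_form g \<Omega> p q \<alpha> \<alpha>) = 0 \<and> 0 < Re (HR_form g \<Omega> p q \<alpha> \<alpha>)) \<and>
     Lam p q = {cadd \<eta> \<rho> |\<eta> \<rho>. \<eta> \<in> lefschetz_image \<omega> p q \<and> \<rho> \<in> primitive \<omega> \<Omega> p q} \<and>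
     lefschetz_image \<omega> p q \<inter> primitive \<omega> \<Omega> p q = {czero} \<and>
     (\<forall>\<eta>\<in>lefschetz_image \<omega> p q. \<forall>\<rho>\<in>primitive \<omega> \<Omega> p q. HR_form g \<Omega> p q \<eta> \<rho> = 0)"

text \<open>Here \<open>g\<close> is the auxiliary Hermitian metric defining the Hodge star.\<close>

definition balanced_HR_type_on ::
    "('n::{finite,linorder} cspace \<Rightarrow> 'n cspace) set \<Rightarrow> 'n cform \<Rightarrow> 'n cform \<Rightarrow> bool" where
  "balanced_HR_type_on G g F \<longleftrightarrow>
     balanced_metric_on G F \<and>
     (\<exists>\<omega> \<Omega>. hermitian_metric_on G \<omega> \<and>
        form_on G \<Omega> \<and> has_type (CARD('n) - 2) (CARD('n) - 2) \<Omega> \<and> real_form \<Omega> \<and>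
        (\<forall>x. cscale (1 / fact (CARD('n) - 1)) (wedge_power (F x) (CARD('n) - 1))
             = wedge (\<omega> x) (\<Omega> x)) \<and>
        (\<forall>p q. p + q = 2 \<longrightarrow> (\<forall>x. hodge_riemann_at (g x) (\<omega> x) (\<Omega> x) p q)) \<and>
        closed_form \<Omega> \<and> closed_form (\<lambda>x. wedge (\<omega> x) (\<Omega> x)))"

definition heis :: "complex set \<Rightarrow> (complex ^ 3 ^ 3) set" where
  "heis R = {A. (\<forall>i. A $ i $ i = 1) \<and> A $ 2 $ 1 = 0 \<and> A $ 3 $ 1 = 0 \<and> A $ 3 $ 2 = 0 \<and>
     A $ 1 $ 2 \<in> R \<and> A $ 2 $ 3 \<in> R \<and> A $ 1 $ 3 \<in> R}"

definition gaussian_ints :: "complex set" where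
  "gaussian_ints = {z. Re z \<in> \<int> \<and> Im z \<in> \<int>}"

text \<open>
  The complex Lie group \<open>H \<times> \<complex>\<close>, with \<open>H = heis UNIV\<close>, has the global holomorphic chart
  \<open>HC_coords\<close>, whose inverse is \<open>HC_point\<close>.
\<close>

type_synonym heis_C = "(complex ^ 3 ^ 3) \<times> complex"

definition HC_mult :: "heis_C \<Rightarrow> heis_C \<Rightarrow> heis_C" where
  "HC_mult a b = (fst a ** fst b, snd a + snd b)"

definition HC_coords :: "heis_C \<Rightarrow> complex ^ 4" where
  "HC_coords a = vector [fst a $ 1 $ 2, fst a $ 2 $ 3, fst a $ 1 $ 3, snd a]"

definition HC_point :: "complex ^ 4 \<Rightarrow> heis_C" where
  "HC_point x = (vector [vector [1, x $ 1, x $ 3], vector [0, 1, x $ 2], vector [0, 0, 1]], x $ 4)"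

definition left_translation :: "heis_C \<Rightarrow> complex ^ 4 \<Rightarrow> complex ^ 4" where
  "left_translation a x = HC_coords (HC_mult a (HC_point x))"

text \<open>
  \<open>\<I> \<times> \<complex>\<close> is the quotient of \<open>H \<times> \<complex>\<close> by left translations by \<open>\<Gamma> \<times> {0}\<close>,
  where \<open>\<Gamma> = heis gaussian_ints\<close>.
\<close>

definition iwasawa_C :: "(complex ^ 4 \<Rightarrow> complex ^ 4) set" where
  "iwasawa_C = {left_translation (A, 0) |A. A \<in> heis gaussian_ints}"

definition invariant_metric :: "4 cform \<Rightarrow> bool" where
  "invariant_metric F \<longleftrightarrow> (\<forall>A\<in>heis UNIV. \<forall>c. pullback (left_translation (A, c)) F = F)"

lemma vector_4_nth [simp]:
  "(vector [a, b, c, d] :: 'a::zero ^ 4) $ 1 = a"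
  "(vector [a, b, c, d] :: 'a::zero ^ 4) $ 2 = b"
  "(vector [a, b, c, d] :: 'a::zero ^ 4) $ 3 = c"
  "(vector [a, b, c, d] :: 'a::zero ^ 4) $ 4 = d"
  by (simp_all add: vector_def)

lemma HC_point_in: "HC_point x \<in> heis UNIV \<times> UNIV"
  by (simp add: HC_point_def heis_def forall_3)

lemma HC_coords_point: "HC_coords (HC_point x) = x"
  by (simp add: HC_coords_def HC_point_def vec_eq_iff forall_4)

lemma HC_point_coords: "a \<in> heis UNIV \<times> UNIV \<Longrightarrow> HC_point (HC_coords a) = a"
  by (cases a) (simp add: HC_coords_def HC_point_def heis_def vec_eq_iff forall_3)

lemma HC_mult_in:
  "a \<in> heis UNIV \<times> UNIV \<Longrightarrow> b \<in> heis UNIV \<times> UNIV \<Longrightarrow> HC_mult a b \<in> heis UNIV \<times> UNIV"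
  by (cases a; cases b)
     (simp add: HC_mult_def heis_def forall_3 matrix_matrix_mult_def sum_3)

lemma left_translation_eq:
  assumes "A \<in> heis UNIV"
  shows "left_translation (A, c) x =
    vector [x $ 1 + A $ 1 $ 2, x $ 2 + A $ 2 $ 3, x $ 3 + A $ 1 $ 2 * x $ 2 + A $ 1 $ 3, x $ 4 + c]"
  using assms
  by (simp add: left_translation_def HC_coords_def HC_mult_def HC_point_def heis_def forall_3
      matrix_matrix_mult_def sum_3 vec_eq_iff forall_4)

end

theory Submission
  imports Defs
begin

text \<open>
  Let \<open>\<phi>_1 = dz_1\<close>, \<open>\<phi>_2 = dz_2\<close>, \<open>\<phi>_3 = dz_3 - z_1 dz_2\<close>, \<open>\<phi>_4 = dz_4\<close> be the left-invariant frame, so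
  that \<open>d\<phi>_3 = - \<phi>_1 \<and> \<phi>_2\<close>, and put \<open>\<omega>_j = i \<phi>_j \<and> \<phi>bar_j\<close> and \<open>u = 1 + |z_4|\<^sup>2\<close>. The form
  \<open>i \<partial> \<partial>bar (u \<omega>_3) = \<omega>_3 \<omega>_4 + u \<omega>_1 \<omega>_2 + X\<close> is closed; its cross term \<open>X\<close> has coefficients of modulus
  \<open>|z_4|\<close> at \<open>\<phi>_1 \<phi>_2 \<phi>bar_3 \<phi>bar_4\<close> and its conjugate. With \<open>\<omega> = \<omega>_1 + \<omega>_2 + \<omega>_3 / u + \<omega>_4\<close>, adding the
  closed terms \<open>\<omega>_1 \<omega>_3 + \<omega>_2 \<omega>_3 + u (\<omega>_1 \<omega>_4 + \<omega>_2 \<omega>_4)\<close> gives \<open>\<Omega> = u \<omega>\<^sup>2 / 2 + X\<close>. Since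
  \<open>\<omega> \<and> X = 0\<close>, the form \<open>\<omega> \<and> \<Omega> = u \<omega>\<^sup>3 / 2\<close> is \<open>F\<^sup>3 / 3!\<close> for \<open>F = (3 u)\<^bsup>1/3\<^esup> \<omega>\<close>, and it is closed because
  among its coefficients only that of \<open>\<omega>_1 \<omega>_2 \<omega>_4\<close> depends on \<open>z_4\<close>, and \<open>\<omega>_4\<close> absorbs
  its differential. The Hodge-Riemann property is that of \<open>\<omega>\<^sup>2\<close> perturbed by \<open>X\<close>: the perturbed blocks stay positive as \<open>u - |z_4|\<^sup>2 = 1 > 0\<close>. Finally, \<open>F\<close> is
  invariant under \<open>H\<close> but not under translations of \<open>z_4\<close>.
\<close>

section \<open>Wedge products\<close>

text \<open>Numerals of type \<open>4\<close> are residues modulo 4, so \<open>4\<close> equals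
  \<open>0\<close> and is the least index. All ordering signs below follow
  \<open>4 < 1 < 2 < 3\<close>.\<close>

lemma less_4 [simp]:
  "(4::4) < 1" "(4::4) < 2" "(4::4) < 3" "(1::4) < 2" "(1::4) < 3" "(2::4) < 3"
  "\<not> (1::4) < 4" "\<not> (2::4) < 4" "\<not> (3::4) < 4" "\<not> (2::4) < 1" "\<not> (3::4) < 1" "\<not> (3::4) < 2"
  by (simp_all add: less_bit0_def bit0.Rep_numeral bit0.Rep_1)

text \<open>This is \<open>shuffle_sign {a} B\<close>, the sign of moving \<open>dz_a\<close> past
  the factors of smaller index. With \<open>shuffle_sign_insert\<close> it makes shuffle signs of
  explicit sets computable by rewriting.\<close>

definition sgn_below :: "'n::linorder \<Rightarrow> 'n set \<Rightarrow> complex" where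
  "sgn_below a B = (-1) ^ card {b \<in> B. b < a}"

lemma sgn_below_empty [simp]: "sgn_below a {} = 1"
  by (simp add: sgn_below_def)

lemma sgn_below_insert [simp]:
  assumes "b \<notin> B" "finite B"
  shows "sgn_below a (insert b B) = (if b < a then - sgn_below a B else sgn_below a B)"
proof -
  have "{x \<in> insert b B. x < a} = (if b < a then insert b {x \<in> B. x < a} else {x \<in> B. x < a})"
    by auto
  then show ?thesis using assms by (simp add: sgn_below_def)
qed

lemma shuffle_sign_empty [simp]: "shuffle_sign {} B = 1" "shuffle_sign A {} = 1"
  by (simp_all add: shuffle_sign_def)

lemma shuffle_sign_insert [simp]:
  fixes B :: "'n::{finite,linorder} set"
  assumes "a \<notin> A"
  shows "shuffle_sign (insert a A) B = sgn_below a B * shuffle_sign A B"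
proof -
  have "{(x, y). x \<in> insert a A \<and> y \<in> B \<and> y < x}
      = Pair a ` {b \<in> B. b < a} \<union> {(x, y). x \<in> A \<and> y \<in> B \<and> y < x}"
    by auto
  moreover have "card (Pair a ` {b \<in> B. b < a} \<union> {(x, y). x \<in> A \<and> y \<in> B \<and> y < x})
     = card {b \<in> B. b < a} + card {(x, y). x \<in> A \<and> y \<in> B \<and> y < x}"
    using assms by (subst card_Un_disjoint) (auto simp: card_image inj_on_def)
  ultimately show ?thesis
    by (simp add: shuffle_sign_def sgn_below_def power_add)
qed

lemma wedge_dz:
  "wedge (dz j) \<beta> I J = (if j \<in> I then sgn_below j (I - {j}) * \<beta> (I - {j}) J else 0)"
proof -
  have "wedge (dz j) \<beta> I J = (\<Sum>A\<in>Pow I. if A = {j} then sgn_below j (I - {j}) * \<beta> (I - {j}) J else 0)"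
    unfolding wedge_def
  proof (rule sum.cong[OF refl])
    fix A assume "A \<in> Pow I"
    have "(\<Sum>B\<in>Pow J. (-1) ^ (card B * card (I - A)) * shuffle_sign A (I - A) * shuffle_sign B (J - B)
       * dz j A B * \<beta> (I - A) (J - B))
      = (\<Sum>B\<in>Pow J. if B = {} then shuffle_sign A (I - A) * dz j A {} * \<beta> (I - A) J else 0)"
      by (rule sum.cong[OF refl]) (auto simp: dz_def)
    then show "(\<Sum>B\<in>Pow J. (-1) ^ (card B * card (I - A)) * shuffle_sign A (I - A) * shuffle_sign B (J - B)
       * dz j A B * \<beta> (I - A) (J - B)) = (if A = {j} then sgn_below j (I - {j}) * \<beta> (I - {j}) J else 0)"
      by (simp add: dz_def)
  qed
  then show ?thesis by simp
qed

lemma wedge_dzbar: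
  "wedge (dzbar j) \<beta> I J =
     (if j \<in> J then (-1) ^ card I * sgn_below j (J - {j}) * \<beta> I (J - {j}) else 0)"
proof -
  have "wedge (dzbar j) \<beta> I J = (\<Sum>A\<in>Pow I. if A = {} then (if j \<in> J then (-1) ^ card I * sgn_below j (J - {j}) * \<beta> I (J - {j}) else 0) else 0)"
    unfolding wedge_def
  proof (rule sum.cong[OF refl])
    fix A assume "A \<in> Pow I"
    have "(\<Sum>B\<in>Pow J. (-1) ^ (card B * card (I - A)) * shuffle_sign A (I - A) * shuffle_sign B (J - B)
       * dzbar j A B * \<beta> (I - A) (J - B))
      = (\<Sum>B\<in>Pow J. if B = {j} then (-1) ^ card (I - A) * shuffle_sign A (I - A) * sgn_below j (J - {j}) * dzbar j A {j} * \<beta> (I - A) (J - {j}) else 0)"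
      by (rule sum.cong[OF refl]) (auto simp: dzbar_def)
    then show "(\<Sum>B\<in>Pow J. (-1) ^ (card B * card (I - A)) * shuffle_sign A (I - A) * shuffle_sign B (J - B)
       * dzbar j A B * \<beta> (I - A) (J - B)) = (if A = {} then (if j \<in> J then (-1) ^ card I * sgn_below j (J - {j}) * \<beta> I (J - {j}) else 0) else 0)"
      by (auto simp add: dzbar_def)
  qed
  then show ?thesis by simp
qed

text \<open>Only singletons \<open>A\<close> and \<open>B\<close> carry coefficients of \<alpha>.
  The exponent \<open>card I - 1\<close> counts the remaining holomorphic factors that
  \<open>dzbar_j\<close> has to pass.\<close>

lemma wedge_11:
  assumes "\<alpha> \<in> Lam 1 1"
  shows "wedge \<alpha> \<beta> I J = (\<Sum>i\<in>I. \<Sum>j\<in>J. (-1) ^ (card I - 1) * sgn_below i (I - {i}) *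
     sgn_below j (J - {j}) * \<alpha> {i} {j} * \<beta> (I - {i}) (J - {j}))"
proof -
  let ?f = "\<lambda>A B. (-1) ^ (card B * card (I - A)) * shuffle_sign A (I - A) * shuffle_sign B (J - B)
       * \<alpha> A B * \<beta> (I - A) (J - B)"
  have z: "\<alpha> A B = 0" if "\<not> (card A = 1 \<and> card B = 1)" for A B
    using assms that by (auto simp: Lam_def)
  have "wedge \<alpha> \<beta> I J = (\<Sum>A\<in>(\<lambda>i. {i}) ` I. \<Sum>B\<in>Pow J. ?f A B)"
    unfolding wedge_def
    by (rule sum.mono_neutral_right) (auto intro!: sum.neutral z simp: card_1_singleton_iff)
  also have "\<dots> = (\<Sum>A\<in>(\<lambda>i. {i}) ` I. \<Sum>B\<in>(\<lambda>i. {i}) ` J. ?f A B)"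
    by (intro sum.cong[OF refl] sum.mono_neutral_right) (auto intro!: z simp: card_1_singleton_iff)
  also have "\<dots> = (\<Sum>i\<in>I. \<Sum>j\<in>J. ?f {i} {j})"
    by (simp add: sum.reindex)
  also have "\<dots> = (\<Sum>i\<in>I. \<Sum>j\<in>J. (-1) ^ (card I - 1) * sgn_below i (I - {i}) *
     sgn_below j (J - {j}) * \<alpha> {i} {j} * \<beta> (I - {i}) (J - {j}))"
    by (intro sum.cong refl) (simp add: card_Diff_singleton)
  finally show ?thesis .
qed

lemma conj_covec_wedge: "conj_covec (wedge \<alpha> \<beta>) = wedge (conj_covec \<alpha>) (conj_covec \<beta>)"
proof (intro ext)
  fix I J
  have "conj_covec (wedge \<alpha> \<beta>) I J = (\<Sum>B\<in>Pow J. \<Sum>A\<in>Pow I.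
     (-1) ^ (card I * card J) * cnj ((-1) ^ (card A * card (J - B)) * shuffle_sign B (J - B) * shuffle_sign A (I - A)
       * \<alpha> B A * \<beta> (J - B) (I - A)))"
    by (simp add: conj_covec_def wedge_def sum_distrib_left)
  also have "\<dots> = (\<Sum>A\<in>Pow I. \<Sum>B\<in>Pow J.
     (-1) ^ (card I * card J) * cnj ((-1) ^ (card A * card (J - B)) * shuffle_sign B (J - B) * shuffle_sign A (I - A)
       * \<alpha> B A * \<beta> (J - B) (I - A)))"
    by (rule sum.swap)
  also have "\<dots> = wedge (conj_covec \<alpha>) (conj_covec \<beta>) I J"
    unfolding wedge_def
  proof (intro sum.cong refl)
    fix A B assume "A \<in> Pow I" "B \<in> Pow J"
    then have c: "card I = card A + card (I - A)" "card J = card B + card (J - B)"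
      by (auto simp: card_Diff_subset card_mono finite_subset[OF subset_UNIV])
    have s: "cnj (shuffle_sign X Y) = shuffle_sign X Y" for X Y :: "'a set"
      by (simp add: shuffle_sign_def)
    \<comment> \<open>Multiplying out \<open>card I * card J\<close>, the exponents of the two sides
      differ by \<open>2 * (card A * card (J - B))\<close>, which is even.\<close>
    have e: "(-1::complex) ^ (card I * card J) * (-1) ^ (card A * card (J - B))
        = (-1) ^ (card B * card (I - A)) * (-1) ^ (card A * card B) * (-1) ^ (card (I - A) * card (J - B))"
    proof -
      have "card I * card J + card A * card (J - B)
          = card B * card (I - A) + card A * card B + card (I - A) * card (J - B) + 2 * (card A * card (J - B))"
        unfolding c by (simp add: algebra_simps)
      then have "(-1::complex) ^ (card I * card J + card A * card (J - B))
          = (-1) ^ (card B * card (I - A) + card A * card B + card (I - A) * card (J - B) + 2 * (card A * card (J - B)))"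
        by (rule arg_cong)
      then show ?thesis by (simp add: power_add power_mult)
    qed
    show "(-1) ^ (card I * card J) * cnj ((-1) ^ (card A * card (J - B)) * shuffle_sign B (J - B) * shuffle_sign A (I - A)
       * \<alpha> B A * \<beta> (J - B) (I - A)) =
       (-1) ^ (card B * card (I - A)) * shuffle_sign A (I - A) * shuffle_sign B (J - B)
       * conj_covec \<alpha> A B * conj_covec \<beta> (I - A) (J - B)"
      using arg_cong[OF e, of "\<lambda>t. t * shuffle_sign A (I - A) * shuffle_sign B (J - B) * cnj (\<alpha> B A) * cnj (\<beta> (J - B) (I - A))"]
      by (simp add: conj_covec_def s mult_ac)
  qed
  finally show "conj_covec (wedge \<alpha> \<beta>) I J = wedge (conj_covec \<alpha>) (conj_covec \<beta>) I J" .
qed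

lemma conj_covec_conj_covec [simp]: "conj_covec (conj_covec \<alpha>) = \<alpha>"
  by (auto simp: conj_covec_def fun_eq_iff mult_ac simp flip: power_add)

lemma wedge_cadd_right: "wedge \<alpha> (cadd \<beta> \<gamma>) = cadd (wedge \<alpha> \<beta>) (wedge \<alpha> \<gamma>)"
  by (simp add: wedge_def cadd_def fun_eq_iff distrib_left sum.distrib)

lemma wedge_cscale_right: "wedge \<alpha> (cscale c \<beta>) = cscale c (wedge \<alpha> \<beta>)"
  by (simp add: wedge_def cscale_def fun_eq_iff sum_distrib_left mult_ac)

lemma wedge_cscale_left: "wedge (cscale c \<alpha>) \<beta> = cscale c (wedge \<alpha> \<beta>)"
  by (simp add: wedge_def cscale_def fun_eq_iff sum_distrib_left mult_ac)

lemma Lam_wedge: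
  assumes "\<alpha> \<in> Lam p q" "\<beta> \<in> Lam r s"
  shows "wedge \<alpha> \<beta> \<in> Lam (p + r) (q + s)"
proof -
  have "card I = p + r \<and> card J = q + s" if "wedge \<alpha> \<beta> I J \<noteq> 0" for I J
  proof -
    from that obtain A where A: "A \<in> Pow I" "(\<Sum>B\<in>Pow J.
     (-1) ^ (card B * card (I - A)) * shuffle_sign A (I - A) * shuffle_sign B (J - B)
       * \<alpha> A B * \<beta> (I - A) (J - B)) \<noteq> 0"
      unfolding wedge_def by (meson sum.neutral)
    then obtain B where B: "B \<in> Pow J" "\<alpha> A B * \<beta> (I - A) (J - B) \<noteq> 0"
      by (metis (no_types, lifting) mult.assoc mult_zero_right sum.neutral)
    then have "card A = p" "card B = q" "card (I - A) = r" "card (J - B) = s"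
      using assms by (auto simp: Lam_def)
    moreover have "card I = card A + card (I - A)" "card J = card B + card (J - B)"
      using A(1) B(1) by (auto simp: card_Diff_subset card_mono finite_subset[OF subset_UNIV])
    ultimately show ?thesis by simp
  qed
  then show ?thesis by (auto simp: Lam_def)
qed

section \<open>The shear of the coframe\<close>

lemma set_4_cases: "I \<in> {{},{1},{2},{3},{4},{1,2},{1,3},{1,4},{2,3},{2,4},{3,4},
   {1,2,3},{1,2,4},{1,3,4},{2,3,4},{1,2,3,4}}" for I :: "4 set"
proof -
  have "I \<in> Pow {1,2,3,4}" using UNIV_4 by auto
  then show ?thesis by (simp add: Pow_insert insert_commute)
qed

text \<open>The holomorphic part of \<open>wedge\<close>: the sum over \<open>A\<close> alone, when
  the left factor has antiholomorphic degree \<open>m\<close>, so that \<open>dz_(I - A)\<close> has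
  to pass \<open>m\<close> conjugate factors.\<close>

definition hsum :: "nat \<Rightarrow> ('n::linorder set \<Rightarrow> complex) \<Rightarrow> ('n set \<Rightarrow> complex) \<Rightarrow> 'n set \<Rightarrow> complex" where
  "hsum m a b I = (\<Sum>A\<in>Pow I. (-1) ^ (m * card (I - A)) * shuffle_sign A (I - A) * a A * b (I - A))"

text \<open>The effect of \<open>dz_3 \<mapsto> dz_3 + t dz_2\<close> on coefficients: a monomial
  with \<open>3\<close> but without \<open>2\<close> also contributes to the one with
  \<open>2\<close> in place of \<open>3\<close>. If both indices occur, the extra term contains
  \<open>dz_2\<close> twice and vanishes.\<close>

definition hshear :: "complex \<Rightarrow> (4 set \<Rightarrow> complex) \<Rightarrow> 4 set \<Rightarrow> complex" where
  "hshear t a I = a I + (if 2 \<in> I \<and> 3 \<notin> I then t * a (insert 3 (I - {2})) else 0)"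

lemma sum_Pow_insert:
  assumes "x \<notin> S" "finite S"
  shows "(\<Sum>A\<in>Pow (insert x S). f A) = (\<Sum>A\<in>Pow S. f A) + (\<Sum>A\<in>Pow S. f (insert x A))"
proof -
  have "inj_on (insert x) (Pow S)" using assms by (auto simp: inj_on_def)
  then show ?thesis using assms
    unfolding Pow_insert by (subst sum.union_disjoint) (auto simp: sum.reindex)
qed

lemma insert_Diff_insert [simp]:
  "insert a A - insert b B = (if a \<in> insert b B then A - insert b B else insert a (A - insert b B))"
  by auto

text \<open>A linear substitution of the generators is multiplicative, and it preserves degrees,
  hence also the signs governed by \<open>m\<close>. The identity is verified on each of the sixteen
  index sets.\<close>

lemma hsum_hshear: "hsum m (hshear t a) (hshear t b) I = hshear t (hsum m a b) I"
  using set_4_cases[of I]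
  apply (elim insertE emptyE; simp add: hsum_def hshear_def sum_Pow_insert power_add power_mult insert_commute)
  apply (simp_all add: algebra_simps)
  done

definition shear_hol :: "complex \<Rightarrow> 4 covec \<Rightarrow> 4 covec" where
  "shear_hol t \<alpha> = (\<lambda>I J. hshear t (\<lambda>A. \<alpha> A J) I)"

definition shear_anti :: "complex \<Rightarrow> 4 covec \<Rightarrow> 4 covec" where
  "shear_anti t \<alpha> = (\<lambda>I J. hshear t (\<alpha> I) J)"

text \<open>This is the substitution \<open>dz_3 \<mapsto> dz_3 + t dz_2\<close>, \<open>dzbar_3 \<mapsto> dzbar_3 + cnj t dzbar_2\<close>. No signs occur
  because \<open>2\<close> and \<open>3\<close> are adjacent in the order of the index type, which is \<open>4 < 1 < 2 < 3\<close>.\<close>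

definition shear :: "complex \<Rightarrow> 4 covec \<Rightarrow> 4 covec" where
  "shear t \<alpha> = shear_hol t (shear_anti (cnj t) \<alpha>)"

lemma wedge_hsum:
  "wedge \<alpha> \<beta> I J = (\<Sum>B\<in>Pow J. shuffle_sign B (J - B) *
     hsum (card B) (\<lambda>A. \<alpha> A B) (\<lambda>A. \<beta> A (J - B)) I)"
  unfolding wedge_def hsum_def
  by (subst sum.swap) (simp add: sum_distrib_left mult_ac)

text \<open>For fixed \<open>B\<close> the antiholomorphic indices are untouched, so the
  multiplicativity of \<open>hshear\<close> applies to each summand of
  \<open>wedge_hsum\<close>.\<close>

lemma shear_hol_wedge: "shear_hol t (wedge \<alpha> \<beta>) = wedge (shear_hol t \<alpha>) (shear_hol t \<beta>)"
proof (intro ext)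
  fix I J
  have "shear_hol t (wedge \<alpha> \<beta>) I J = (\<Sum>B\<in>Pow J. shuffle_sign B (J - B) *
     hshear t (hsum (card B) (\<lambda>A. \<alpha> A B) (\<lambda>A. \<beta> A (J - B))) I)"
    by (cases "2 \<in> I"; cases "3 \<in> I")
      (simp_all add: shear_hol_def wedge_hsum hshear_def sum_distrib_left sum.distrib distrib_left mult_ac)
  then show "shear_hol t (wedge \<alpha> \<beta>) I J = wedge (shear_hol t \<alpha>) (shear_hol t \<beta>) I J"
    by (simp add: wedge_hsum hsum_hshear shear_hol_def)
qed

lemma card_replace [simp]: "2 \<in> J \<Longrightarrow> 3 \<notin> J \<Longrightarrow> card (insert 3 (J - {2})) = card J" for J :: "4 set"
  using card_Suc_Diff1[of J 2] by simp

lemma conj_shear_hol: "conj_covec (shear_hol t \<alpha>) = shear_anti (cnj t) (conj_covec \<alpha>)"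
  by (auto simp: conj_covec_def shear_hol_def shear_anti_def hshear_def fun_eq_iff algebra_simps
      simp del: card_insert_disjoint)

lemma conj_shear_anti: "conj_covec (shear_anti t \<alpha>) = shear_hol (cnj t) (conj_covec \<alpha>)"
  by (auto simp: conj_covec_def shear_hol_def shear_anti_def hshear_def fun_eq_iff algebra_simps
      simp del: card_insert_disjoint)

lemma shear_hol_anti_commute: "shear_hol s (shear_anti t \<alpha>) = shear_anti t (shear_hol s \<alpha>)"
  by (auto simp: shear_hol_def shear_anti_def hshear_def fun_eq_iff algebra_simps)

text \<open>Conjugation is multiplicative and exchanges \<open>shear_hol\<close> with
  \<open>shear_anti\<close>, so the holomorphic case carries over.\<close>

lemma shear_anti_wedge: "shear_anti t (wedge \<alpha> \<beta>) = wedge (shear_anti t \<alpha>) (shear_anti t \<beta>)"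
  using arg_cong[OF shear_hol_wedge[of "cnj t" "conj_covec \<alpha>" "conj_covec \<beta>"], of conj_covec]
  by (simp add: conj_covec_wedge conj_shear_hol)

lemma shear_wedge: "shear t (wedge \<alpha> \<beta>) = wedge (shear t \<alpha>) (shear t \<beta>)"
  by (simp add: shear_def shear_hol_wedge shear_anti_wedge)

lemma conj_shear: "conj_covec (shear t \<alpha>) = shear t (conj_covec \<alpha>)"
  by (simp add: shear_def conj_shear_hol conj_shear_anti shear_hol_anti_commute)

lemma shear_hol_shear_hol: "shear_hol s (shear_hol t \<alpha>) = shear_hol (s + t) \<alpha>"
  by (auto simp: shear_hol_def hshear_def fun_eq_iff algebra_simps)

lemma shear_anti_shear_anti: "shear_anti s (shear_anti t \<alpha>) = shear_anti (s + t) \<alpha>"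
  by (auto simp: shear_anti_def hshear_def fun_eq_iff algebra_simps)

text \<open>The shears form an additive group in the parameter; in particular
  \<open>shear (- t)\<close> is the inverse of \<open>shear t\<close>.\<close>

lemma shear_shear: "shear s (shear t \<alpha>) = shear (s + t) \<alpha>"
  unfolding shear_def
  by (metis complex_cnj_add shear_anti_shear_anti shear_hol_anti_commute shear_hol_shear_hol)

lemma shear_0 [simp]: "shear 0 \<alpha> = \<alpha>"
  by (simp add: shear_def shear_hol_def shear_anti_def hshear_def cong: if_cong)

lemma shear_cadd: "shear t (cadd \<alpha> \<beta>) = cadd (shear t \<alpha>) (shear t \<beta>)"
  by (auto simp: shear_def shear_hol_def shear_anti_def hshear_def cadd_def fun_eq_iff algebra_simps)

lemma shear_cscale: "shear t (cscale c \<alpha>) = cscale c (shear t \<alpha>)"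
  by (auto simp: shear_def shear_hol_def shear_anti_def hshear_def cscale_def fun_eq_iff algebra_simps)

lemma shear_czero [simp]: "shear t czero = czero"
  by (auto simp: shear_def shear_hol_def shear_anti_def hshear_def czero_def fun_eq_iff)

lemma shear_eq_iff [simp]: "shear t \<alpha> = shear t \<beta> \<longleftrightarrow> \<alpha> = \<beta>"
  by (metis add.left_inverse shear_0 shear_shear)

lemma shear_Lam: "\<alpha> \<in> Lam p q \<Longrightarrow> shear t \<alpha> \<in> Lam p q"
  unfolding Lam_def shear_def shear_hol_def shear_anti_def hshear_def
  apply (clarsimp split: if_splits)
  by (metis add.right_neutral card_replace mult_zero_right)

text \<open>The substitution is unipotent and so fixes top coefficients; the Hodge star of a
  top-degree form does not change under it.\<close>

lemma shear_UNIV [simp]: "shear t \<alpha> UNIV UNIV = \<alpha> UNIV UNIV"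
  by (simp add: shear_def shear_hol_def shear_anti_def hshear_def)

text \<open>The monomial \<open>dz_I \<and> dzbar_J\<close>.\<close>

definition frame :: "'n set \<Rightarrow> 'n set \<Rightarrow> 'n covec" where
  "frame I J = (\<lambda>K L. if K = I \<and> L = J then 1 else 0)"

lemma shear_frame:
  "shear t (dz j) = (if j = 3 then cadd (dz 3) (cscale t (dz 2)) else dz j)"
  "shear t (dzbar j) = (if j = 3 then cadd (dzbar 3) (cscale (cnj t) (dzbar 2)) else dzbar j)"
  "shear t cone = cone"
proof -
  have 1: "insert 3 (K - {2}) = {j} \<longleftrightarrow> j = 3 \<and> K = {2}" if "2 \<in> K" "3 \<notin> K" for j and K :: "4 set"
    using that by auto
  show  "shear t (dz j) = (if j = 3 then cadd (dz 3) (cscale t (dz 2)) else dz j)"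
    by (auto simp: shear_def shear_hol_def shear_anti_def hshear_def fun_eq_iff dz_def cadd_def cscale_def 1)
  show "shear t (dzbar j) = (if j = 3 then cadd (dzbar 3) (cscale (cnj t) (dzbar 2)) else dzbar j)"
    by (auto simp: shear_def shear_hol_def shear_anti_def hshear_def fun_eq_iff dzbar_def cadd_def cscale_def 1)
  show "shear t cone = cone"
    by (auto simp: shear_def shear_hol_def shear_anti_def hshear_def fun_eq_iff cone_def)
qed

lemma shear_wedge_list: "shear t (wedge_list \<alpha>s) = wedge_list (map (shear t) \<alpha>s)"
  by (induction \<alpha>s) (simp_all add: wedge_list_def shear_wedge shear_frame)

lemma sgn_below_least: "(\<And>b. b \<in> B \<Longrightarrow> a < b) \<Longrightarrow> sgn_below a B = 1"
  unfolding sgn_below_def by (metis (mono_tags, lifting) card.empty empty_Collect_eq order_less_asym power_0)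

text \<open>Each new factor on the left has an index below those of its own kind already present,
  and conjugate factors enter before any holomorphic one, so no sign arises.\<close>

lemma wedge_list_dz_dzbar:
  assumes "sorted_wrt (<) xs" "sorted_wrt (<) ys"
  shows "wedge_list (map dz xs @ map dzbar ys) = frame (set xs) (set ys)"
  using assms
proof (induction xs)
  case Nil
  then show ?case
  proof (induction ys)
    case Nil
    show ?case by (simp add: wedge_list_def frame_def cone_def)
  next
    case (Cons y ys)
    then have "wedge_list (map dz [] @ map dzbar (y # ys)) = wedge (dzbar y) (frame {} (set ys))"
      by (simp add: wedge_list_def)
    moreover have "y \<notin> set ys" using Cons by auto
    ultimately show ?case using Cons.prems
      by (auto simp: fun_eq_iff wedge_dzbar frame_def sgn_below_least)
  qed
next
  case (Cons x xs)
  then have "wedge_list (map dz (x # xs) @ map dzbar ys) = wedge (dz x) (frame (set xs) (set ys))"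
    by (simp add: wedge_list_def)
  moreover have "x \<notin> set xs" using Cons by auto
  ultimately show ?case using Cons.prems
    by (auto simp: fun_eq_iff wedge_dz frame_def sgn_below_least)
qed

lemma sum_frame: "(\<Sum>I\<in>UNIV. \<Sum>J\<in>UNIV. \<alpha> I J * frame I J K L) = (\<alpha> K L :: complex)"
  for K L :: "'n::finite set"
proof -
  have "(\<Sum>J\<in>UNIV. \<alpha> I J * frame I J K L) = (if I = K then \<alpha> I L else 0)" for I
    by (simp add: frame_def if_distrib cong: if_cong)
  then show ?thesis by simp
qed

section \<open>Wirtinger derivatives, pullbacks and exterior derivatives\<close>

text \<open>The total derivative is written as \<Sum> \<open>p_j dz_j + q_j dzbar_j\<close>. Unlike
  \<open>pdz\<close> and \<open>pdzbar\<close>, this includes differentiability, so it composes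
  under sums, products and conjugation.\<close>

definition has_wirtinger ::
    "(('n::finite) cspace \<Rightarrow> complex) \<Rightarrow> ('n \<Rightarrow> complex) \<Rightarrow> ('n \<Rightarrow> complex) \<Rightarrow> 'n cspace \<Rightarrow> bool" where
  "has_wirtinger f p q x \<longleftrightarrow>
     (f has_derivative (\<lambda>v. \<Sum>j\<in>UNIV. p j * v $ j + q j * cnj (v $ j))) (at x)"

lemma has_wirtinger_pdz:
  assumes "has_wirtinger f p q x"
  shows "pdz j f x = p j" "pdzbar j f x = q j"
proof -
  have d: "frechet_derivative f (at x) = (\<lambda>v. \<Sum>j\<in>UNIV. p j * v $ j + q j * cnj (v $ j))"
    using frechet_derivative_at[OF assms[unfolded has_wirtinger_def]] by simp
  have s: "(\<Sum>k\<in>UNIV. p k * axis j a $ k + q k * cnj (axis j a $ k)) = p j * a + q j * cnj a" for a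
  proof -
    have "(\<Sum>k\<in>UNIV. p k * axis j a $ k + q k * cnj (axis j a $ k))
        = (\<Sum>k\<in>UNIV. if k = j then p j * a + q j * cnj a else 0)"
      by (rule sum.cong) (auto simp: axis_def)
    then show ?thesis by simp
  qed
  show "pdz j f x = p j" "pdzbar j f x = q j"
    by (simp_all add: pdz_def pdzbar_def d s algebra_simps)
qed

lemma has_wirtinger_cong:
  assumes "has_wirtinger f p q x" "\<And>y. f y = g y" "\<And>j. p j = r j" "\<And>j. q j = s j"
  shows "has_wirtinger g r s x"
proof -
  have "f = g" "p = r" "q = s" using assms(2-4) by auto
  then show ?thesis using assms(1) by simp
qed

lemma has_wirtinger_const: "has_wirtinger (\<lambda>x. c) (\<lambda>_. 0) (\<lambda>_. 0) x"
  by (simp add: has_wirtinger_def)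

lemma has_wirtinger_coord: "has_wirtinger (\<lambda>x. x $ i) (\<lambda>j. if j = i then 1 else 0) (\<lambda>_. 0) x"
proof -
  have "(\<Sum>j\<in>UNIV. (if j = i then 1 else 0) * v $ j + 0 * cnj (v $ j)) = v $ i" for v :: "'a cspace"
    by (simp add: if_distrib[of "\<lambda>c. c * _"] cong: if_cong)
  then show ?thesis
    unfolding has_wirtinger_def by (auto intro!: bounded_linear_imp_has_derivative bounded_linear_vec_nth)
qed

lemma has_wirtinger_cnj:
  assumes "has_wirtinger f p q x"
  shows "has_wirtinger (\<lambda>y. cnj (f y)) (\<lambda>j. cnj (q j)) (\<lambda>j. cnj (p j)) x"
  using bounded_linear.has_derivative[OF bounded_linear_cnj assms[unfolded has_wirtinger_def]]
  by (simp add: has_wirtinger_def add.commute)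

lemma has_wirtinger_add:
  assumes "has_wirtinger f p q x" "has_wirtinger g r s x"
  shows "has_wirtinger (\<lambda>y. f y + g y) (\<lambda>j. p j + r j) (\<lambda>j. q j + s j) x"
  using has_derivative_add[OF assms[unfolded has_wirtinger_def]]
  by (simp add: has_wirtinger_def algebra_simps sum.distrib)

lemma has_wirtinger_mult:
  assumes "has_wirtinger f p q x" "has_wirtinger g r s x"
  shows "has_wirtinger (\<lambda>y. f y * g y) (\<lambda>j. f x * r j + p j * g x) (\<lambda>j. f x * s j + q j * g x) x"
  using has_derivative_mult[OF assms[unfolded has_wirtinger_def]]
  by (simp add: has_wirtinger_def algebra_simps sum.distrib sum_distrib_left sum_distrib_right)

lemma ext_deriv_function_form:
  assumes "has_wirtinger f p q x"
  shows "ext_deriv (function_form f) x =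
    (\<lambda>I J. \<Sum>j\<in>UNIV. p j * dz j I J + q j * dzbar j I J)"
proof -
  have 0: "has_wirtinger (\<lambda>y. function_form f y K L) (\<lambda>j. p j * cone K L) (\<lambda>j. q j * cone K L) x" for K L
    using has_wirtinger_mult[OF assms has_wirtinger_const[of "cone K L" x]]
    by (simp add: function_form_def cscale_def)
  have 1: "wedge \<alpha> (\<lambda>K L. c * cone K L) = cscale c (wedge \<alpha> cone)" for \<alpha> :: "'a covec" and c
    using wedge_cscale_right[of \<alpha> c cone] by (simp add: cscale_def)
  have 2: "wedge (dz j) cone = dz j" "wedge (dzbar j) cone = dzbar j" for j :: 'a
    using wedge_list_dz_dzbar[of "[j]" "[]"] wedge_list_dz_dzbar[of "[]" "[j]"]
    by (simp_all add: wedge_list_def frame_def dz_def dzbar_def)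
  show ?thesis
    by (simp add: ext_deriv_def fun_eq_iff has_wirtinger_pdz[OF 0] 1 2 cscale_def)
qed

section \<open>Left translations and their pullbacks\<close>

definition translate_4 :: "complex \<Rightarrow> complex \<Rightarrow> complex \<Rightarrow> complex \<Rightarrow> 4 cspace \<Rightarrow> 4 cspace" where
  "translate_4 a b c d x = vector [x $ 1 + a, x $ 2 + b, x $ 3 + a * x $ 2 + c, x $ 4 + d]"

lemma has_wirtinger_translate_4:
  "has_wirtinger (\<lambda>y. translate_4 a b c d y $ i) (\<lambda>j. if j = i then 1 else if i = 3 \<and> j = 2 then a else 0) (\<lambda>_. 0) x"
proof -
  have k: "has_wirtinger (\<lambda>y. y $ i + b) (\<lambda>j. if j = i then 1 else 0) (\<lambda>_. 0) x" for i b and x :: "4 cspace"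
    using has_wirtinger_add[OF has_wirtinger_coord has_wirtinger_const] by simp
  have "has_wirtinger (\<lambda>y. y $ 3 + a * y $ 2 + c) (\<lambda>j. if j = 3 then 1 else if j = 2 then a else 0) (\<lambda>_. 0) x"
    by (rule has_wirtinger_cong[OF has_wirtinger_add[OF has_wirtinger_add[OF has_wirtinger_coord[of 3]
       has_wirtinger_mult[OF has_wirtinger_const[of a] has_wirtinger_coord[of 2]]] has_wirtinger_const[of c]]])
       auto
  then show ?thesis
    using k[of 1 a x] k[of 2 b x] k[of 4 d x]
    using exhaust_4[of i] by (elim disjE; simp add: translate_4_def cong: if_cong)
qed

text \<open>Only the third component of the translation mixes coordinates, through
  \<open>a * x $ 2\<close>; its Jacobian is therefore the constant shear by
  \<open>a\<close>.\<close>

lemma ext_deriv_translate_4: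
  "ext_deriv (function_form (\<lambda>y. translate_4 a b c d y $ i)) x = shear a (dz i)"
  "ext_deriv (function_form (\<lambda>y. cnj (translate_4 a b c d y $ i))) x = shear a (dzbar i)"
  unfolding ext_deriv_function_form[OF has_wirtinger_translate_4]
    ext_deriv_function_form[OF has_wirtinger_cnj[OF has_wirtinger_translate_4]] shear_frame
  using exhaust_4[of i] by (elim disjE; simp add: fun_eq_iff sum_4 cadd_def cscale_def)+

lemma shear_apply:
  "shear t \<alpha> K L = \<alpha> K L + (if 2 \<in> L \<and> 3 \<notin> L then cnj t else 0) * \<alpha> K (insert 3 (L - {2}))
    + (if 2 \<in> K \<and> 3 \<notin> K then t else 0) * \<alpha> (insert 3 (K - {2})) L
    + (if 2 \<in> K \<and> 3 \<notin> K then t else 0) * (if 2 \<in> L \<and> 3 \<notin> L then cnj t else 0)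
       * \<alpha> (insert 3 (K - {2})) (insert 3 (L - {2}))"
  by (simp add: shear_def shear_hol_def shear_anti_def hshear_def algebra_simps)

text \<open>Both sides are linear in the monomials, and on a monomial the multiplicative map
  \<open>shear a\<close> agrees with the product of the pulled-back differentials.\<close>

lemma pullback_translate_4:
  "pullback (translate_4 a b c d) \<alpha> x = shear a (\<alpha> (translate_4 a b c d x))"
proof -
  have s: "shear a (\<lambda>K L. \<Sum>I\<in>UNIV. \<Sum>J\<in>UNIV. \<beta> I J * f I J K L) K L
      = (\<Sum>I\<in>UNIV. \<Sum>J\<in>UNIV. \<beta> I J * shear a (f I J) K L)" for \<beta> and f :: "4 set \<Rightarrow> 4 set \<Rightarrow> 4 covec" and K L
    unfolding shear_apply by (simp only: sum_distrib_left sum.distrib distrib_left mult_ac)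
  have "pullback (translate_4 a b c d) \<alpha> x = (\<lambda>K L. \<Sum>I\<in>UNIV. \<Sum>J\<in>UNIV. \<alpha> (translate_4 a b c d x) I J *
      shear a (frame I J) K L)"
  proof -
    have "wedge_list (map (\<lambda>i. shear a (dz i)) (sorted_list_of_set I) @
        map (\<lambda>j. shear a (dzbar j)) (sorted_list_of_set J)) = shear a (frame I J)" for I J :: "4 set"
      using shear_wedge_list[of a "map dz (sorted_list_of_set I) @ map dzbar (sorted_list_of_set J)"]
      by (simp add: wedge_list_dz_dzbar strict_sorted_list_of_set comp_def)
    then show ?thesis
      by (simp add: pullback_def ext_deriv_translate_4)
  qed
  also have "\<dots> = shear a (\<alpha> (translate_4 a b c d x))"
    unfolding s[of _ frame, symmetric] sum_frame ..
  finally show ?thesis .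
qed

text \<open>Shearing by \<open>- z_1\<close> turns \<open>dz_j\<close> into \<open>\<phi>_j\<close>; the coefficients in this frame depend on \<open>z_4\<close> only.\<close>

definition sheared_form :: "(complex \<Rightarrow> 4 covec) \<Rightarrow> 4 cform" where
  "sheared_form A x = shear (- x $ 1) (A (x $ 4))"

text \<open>The translation moves \<open>z_1\<close> to \<open>z_1 + a\<close>, and the pullback
  shears by \<open>a\<close> once more; the two contributions cancel. Only the shift of
  \<open>z_4\<close> survives.\<close>

lemma pullback_sheared_form:
  "pullback (translate_4 a b c d) (sheared_form A) x = shear (- x $ 1) (A (x $ 4 + d))"
  by (simp add: pullback_translate_4 sheared_form_def translate_4_def shear_shear)

text \<open>The infinitesimal generator of \<open>shear_hol\<close>: its derivative in the
  parameter, trading \<open>dz_3\<close> for \<open>dz_2\<close>. \<open>replace_anti\<close> is the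
  conjugate counterpart.\<close>

definition replace_hol :: "4 covec \<Rightarrow> 4 covec" where
  "replace_hol \<alpha> = (\<lambda>I J. if 2 \<in> I \<and> 3 \<notin> I then \<alpha> (insert 3 (I - {2})) J else 0)"

definition replace_anti :: "4 covec \<Rightarrow> 4 covec" where
  "replace_anti \<alpha> = (\<lambda>I J. if 2 \<in> J \<and> 3 \<notin> J then \<alpha> I (insert 3 (J - {2})) else 0)"

text \<open>By the product rule, derivatives in \<open>z_4\<close> act on \<open>A\<close>, while
  those in \<open>z_1\<close> act on the shear parameter \<open>- z_1\<close> and produce the
  generators. The conjugate parameter depends antiholomorphically on \<open>z_1\<close>, so it
  contributes only to the second family.\<close>

lemma sheared_form_wirtinger:
  assumes A: "\<And>K L. has_wirtinger (\<lambda>y. A (y $ 4) K L)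
      (\<lambda>j. if j = 4 then A1 K L else 0) (\<lambda>j. if j = 4 then A2 K L else 0) x"
  shows "has_wirtinger (\<lambda>y. sheared_form A y K L)
     (\<lambda>j. if j = 4 then shear (- x $ 1) A1 K L else
           if j = 1 then - shear (- x $ 1) (replace_hol (A (x $ 4))) K L else 0)
     (\<lambda>j. if j = 4 then shear (- x $ 1) A2 K L else
           if j = 1 then - shear (- x $ 1) (replace_anti (A (x $ 4))) K L else 0) x"
proof -
  have c: "has_wirtinger (\<lambda>y. - y $ 1) (\<lambda>j. if j = 1 then -1 else 0) (\<lambda>_. 0) x"
    by (rule has_wirtinger_cong[OF has_wirtinger_mult[OF has_wirtinger_const[of "-1"] has_wirtinger_coord[of 1 x]]])
       auto
  note cc = has_wirtinger_cnj[OF c]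
  \<comment> \<open>The four rules match the expansion \<open>shear_apply\<close>, according to
    which of \<open>K\<close> and \<open>L\<close> contain \<open>2\<close> but not
    \<open>3\<close>.\<close>
  note w = has_wirtinger_add[OF has_wirtinger_add[OF has_wirtinger_add[OF
       A[of K L] has_wirtinger_mult[OF c A[of "insert 3 (K - {2})" L]]]
       has_wirtinger_mult[OF cc A[of K "insert 3 (L - {2})"]]]
       has_wirtinger_mult[OF has_wirtinger_mult[OF c cc] A[of "insert 3 (K - {2})" "insert 3 (L - {2})"]]]
     has_wirtinger_add[OF A[of K L] has_wirtinger_mult[OF c A[of "insert 3 (K - {2})" L]]]
     has_wirtinger_add[OF A[of K L] has_wirtinger_mult[OF cc A[of K "insert 3 (L - {2})"]]]
     A[of K L]
  note d = sheared_form_def shear_def shear_hol_def shear_anti_def hshear_def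
     replace_hol_def replace_anti_def
  show ?thesis
  proof (cases "2 \<in> K \<and> 3 \<notin> K"; cases "2 \<in> L \<and> 3 \<notin> L")
    assume c: "2 \<in> K \<and> 3 \<notin> K" "2 \<in> L \<and> 3 \<notin> L"
    show ?thesis
    proof (rule has_wirtinger_cong[OF w(1)], goal_cases)
      case (1 y)
      show ?case using c by (auto simp: d algebra_simps)
    next
      case (2 j)
      show ?case using c by (cases "j = 4"; cases "j = 1") (auto simp: d algebra_simps)
    next
      case (3 j)
      show ?case using c by (cases "j = 4"; cases "j = 1") (auto simp: d algebra_simps)
    qed
  next
    assume c: "2 \<in> K \<and> 3 \<notin> K" "\<not> (2 \<in> L \<and> 3 \<notin> L)"
    show ?thesis
    proof (rule has_wirtinger_cong[OF w(2)], goal_cases)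
      case (1 y)
      show ?case using c by (auto simp: d algebra_simps)
    next
      case (2 j)
      show ?case using c by (cases "j = 4"; cases "j = 1") (auto simp: d algebra_simps)
    next
      case (3 j)
      show ?case using c by (cases "j = 4"; cases "j = 1") (auto simp: d algebra_simps)
    qed
  next
    assume c: "\<not> (2 \<in> K \<and> 3 \<notin> K)" "2 \<in> L \<and> 3 \<notin> L"
    show ?thesis
    proof (rule has_wirtinger_cong[OF w(3)], goal_cases)
      case (1 y)
      show ?case using c by (auto simp: d algebra_simps)
    next
      case (2 j)
      show ?case using c by (cases "j = 4"; cases "j = 1") (auto simp: d algebra_simps)
    next
      case (3 j)
      show ?case using c by (cases "j = 4"; cases "j = 1") (auto simp: d algebra_simps)
    qed
  next
    assume c: "\<not> (2 \<in> K \<and> 3 \<notin> K)" "\<not> (2 \<in> L \<and> 3 \<notin> L)"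
    have "(\<lambda>y. sheared_form A y K L) = (\<lambda>y. A (y $ 4) K L)"
      by (simp only: d c if_False add_0_right)
    moreover have "shear (- x $ 1) B K L = B K L" "replace_hol B K L = 0" "replace_anti B K L = 0"
      "shear (- x $ 1) (replace_hol B) K L = 0" "shear (- x $ 1) (replace_anti B) K L = 0" for B
      by (simp_all only: d c if_False add_0_right)
    ultimately show ?thesis using A[of K L] by (simp cong: if_cong)
  qed
qed

text \<open>Since \<open>dz_1\<close>, \<open>dz_4\<close> and their conjugates are fixed by the
  shear, it can be pulled out of the whole derivative. The terms with \<open>dz_1\<close> and
  \<open>dzbar_1\<close> express the structure equation
  \<open>d\<phi>_3 = - \<phi>_1 \<and> \<phi>_2\<close> and its conjugate.\<close>

lemma ext_deriv_sheared_form: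
  assumes A: "\<And>K L. has_wirtinger (\<lambda>y. A (y $ 4) K L)
      (\<lambda>j. if j = 4 then A1 K L else 0) (\<lambda>j. if j = 4 then A2 K L else 0) x"
  shows "ext_deriv (sheared_form A) x = shear (- x $ 1)
    (cadd (cadd (wedge (dz 4) A1) (wedge (dzbar 4) A2))
      (cscale (-1) (cadd (wedge (dz 1) (replace_hol (A (x $ 4))))
                         (wedge (dzbar 1) (replace_anti (A (x $ 4)))))))"
proof -
  note w = has_wirtinger_pdz[OF sheared_form_wirtinger[of A A1 A2 x, OF A]]
  have m: "wedge \<alpha> (\<lambda>K L. - \<beta> K L) = cscale (-1) (wedge \<alpha> \<beta>)" for \<alpha> \<beta> :: "4 covec"
    using wedge_cscale_right[of \<alpha> "-1" \<beta>] by (simp add: cscale_def)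
  have z: "wedge \<alpha> (\<lambda>K L. 0) = czero" for \<alpha> :: "4 covec"
    by (simp add: wedge_def czero_def)
  let ?s = "shear (- x $ 1)"
  have e: "ext_deriv (sheared_form A) x I J =
      wedge (dz 4) (?s A1) I J + wedge (dzbar 4) (?s A2) I J
      - wedge (dz 1) (?s (replace_hol (A (x $ 4)))) I J
      - wedge (dzbar 1) (?s (replace_anti (A (x $ 4)))) I J" for I J
  proof -
    have n: "(1::4) \<noteq> 4" "(2::4) \<noteq> 4" "(2::4) \<noteq> 1" "(3::4) \<noteq> 4" "(3::4) \<noteq> 1" by simp_all
    show ?thesis
      unfolding ext_deriv_def w sum_4 n[THEN if_not_P] if_P[OF refl] z m
      by (simp only: cscale_def czero_def add_0 add_0_right mult_minus1 diff_conv_add_uminus add_ac)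
  qed
  have "?s (dz 1) = dz 1" "?s (dzbar 1) = dzbar 1" "?s (dz 4) = dz 4" "?s (dzbar 4) = dzbar 4"
    by (simp_all add: shear_frame)
  then show ?thesis
    unfolding shear_cadd shear_cscale shear_wedge
    by (intro ext) (simp add: e cadd_def cscale_def)
qed

section \<open>Smoothness\<close>

lemma Ck_has_derivative:
  assumes "\<And>x. (f has_derivative f' x) (at x)" "\<And>v. Ck k (\<lambda>x. f' x v)"
  shows "Ck (Suc k) f"
proof -
  have "frechet_derivative f (at x) = f' x" for x
    using frechet_derivative_at[OF assms(1)] by simp
  then show ?thesis using assms by (auto simp: differentiable_def)
qed

lemma Ck_SucD: "Ck (Suc k) f \<Longrightarrow> Ck k f"
proof (induction k arbitrary: f)
  case 0
  then show ?case
    by (auto intro!: continuous_at_imp_continuous_on differentiable_imp_continuous_within)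
next
  case (Suc k)
  then show ?case by (metis Ck.simps(2))
qed

lemma Ck_Suc_has_derivative:
  assumes "Ck (Suc k) f"
  shows "(f has_derivative frechet_derivative f (at x)) (at x)"
  using assms frechet_derivative_works by auto

lemma Ck_const: "Ck k (\<lambda>x. c)"
proof (induction k arbitrary: c)
  case (Suc k)
  then show ?case by (intro Ck_has_derivative[where f' = "\<lambda>x v. 0"]) auto
qed auto

lemma Ck_bounded_linear:
  assumes "bounded_linear f"
  shows "Ck k f"
proof (cases k)
  case 0
  then show ?thesis using assms by (simp add: linear_continuous_on)
next
  case (Suc m)
  show ?thesis
    unfolding Suc by (rule Ck_has_derivative[OF bounded_linear_imp_has_derivative[OF assms] Ck_const])
qed

lemma Ck_add:
  assumes "Ck k f" "Ck k g"
  shows "Ck k (\<lambda>x. f x + g x)"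
  using assms
proof (induction k arbitrary: f g)
  case 0
  then show ?case by (auto intro: continuous_on_add)
next
  case (Suc k)
  then show ?case
    by (intro Ck_has_derivative[OF has_derivative_add[OF Ck_Suc_has_derivative Ck_Suc_has_derivative]]) auto
qed

lemma Ck_mult:
  fixes f g :: "'a::real_normed_vector \<Rightarrow> complex"
  assumes "Ck k f" "Ck k g"
  shows "Ck k (\<lambda>x. f x * g x)"
  using assms
proof (induction k arbitrary: f g)
  case 0
  then show ?case by (auto intro: continuous_on_mult)
next
  case (Suc k)
  show ?case
    using Suc.prems(1)[THEN Ck_SucD] Suc.prems(2)[THEN Ck_SucD] Suc.prems
    by (intro Ck_has_derivative[OF has_derivative_mult[OF Ck_Suc_has_derivative Ck_Suc_has_derivative]]
        Ck_add Suc.IH) auto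
qed

definition sq1 :: "complex \<Rightarrow> real" where
  "sq1 z = 1 + (cmod z)\<^sup>2"

lemma sq1_ge_1: "1 \<le> sq1 z"
  by (simp add: sq1_def)

lemma sq1_pos [simp]: "0 < sq1 z"
  using sq1_ge_1[of z] by linarith

lemma of_real_sq1: "complex_of_real (sq1 z) = 1 + z * cnj z"
  by (simp only: sq1_def of_real_add of_real_1 complex_norm_square)

lemma has_derivative_sq1_powr:
  "((\<lambda>x::4 cspace. complex_of_real (sq1 (x $ i) powr a)) has_derivative
    (\<lambda>v. of_real a * of_real (sq1 (x $ i) powr (a - 1)) * of_real (2 * (x $ i \<bullet> v $ i)))) (at x)"
proof -
  have "((\<lambda>x::4 cspace. sq1 (x $ i)) has_derivative (\<lambda>v. 2 * (x $ i \<bullet> v $ i))) (at x)"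
    unfolding sq1_def power2_norm_eq_inner
    by (rule derivative_eq_intros bounded_linear_imp_has_derivative[OF bounded_linear_vec_nth] refl)+
       (simp add: inner_commute)
  then have "((\<lambda>x::4 cspace. sq1 (x $ i) powr a) has_derivative
      (\<lambda>v. (2 * (x $ i \<bullet> v $ i)) * (a * sq1 (x $ i) powr (a - 1)))) (at x)"
    using has_derivative_compose[of "\<lambda>x. sq1 (x $ i)" _ x UNIV "\<lambda>y. y powr a"]
      has_real_derivative_powr[where z = "sq1 (x $ i)" and r = a, OF sq1_pos, unfolded has_field_derivative_def]
    by (fastforce simp: mult_ac)
  then show ?thesis
    by (rule has_derivative_eq_rhs[OF bounded_linear.has_derivative[OF bounded_linear_of_real]])
       (simp add: fun_eq_iff mult_ac)
qed

text \<open>A derivative of a power is a lower power times a real-linear function, so the induction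
  has to run over all exponents at once. This covers \<open>1 / u\<close>, \<open>u\<close> and the
  cube root of \<open>u\<close>.\<close>

lemma Ck_sq1_powr: "Ck k (\<lambda>x::4 cspace. complex_of_real (sq1 (x $ i) powr a))"
proof (induction k arbitrary: a)
  case 0
  show ?case
    by (auto intro!: continuous_intros simp: sq1_def) (metis add_nonneg_eq_0_iff zero_le_one zero_le_power2 zero_neq_one)
next
  case (Suc k)
  show ?case
  proof (rule Ck_has_derivative[OF has_derivative_sq1_powr])
    fix v :: "4 cspace"
    have "bounded_linear (\<lambda>x::4 cspace. complex_of_real (2 * (x $ i \<bullet> v $ i)))"
      by (intro bounded_linear_compose[OF bounded_linear_of_real] bounded_linear_const_mult
          bounded_linear_compose[OF bounded_linear_inner_left] bounded_linear_vec_nth)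
    then show "Ck k (\<lambda>x. of_real a * of_real (sq1 (x $ i) powr (a - 1)) * complex_of_real (2 * (x $ i \<bullet> v $ i)))"
      by (intro Ck_mult Ck_const Suc Ck_bounded_linear)
  qed
qed

lemma Ck_coord: "Ck k (\<lambda>x::'n::finite cspace. x $ i)" "Ck k (\<lambda>x::'n::finite cspace. cnj (x $ i))"
  by (intro Ck_bounded_linear bounded_linear_vec_nth bounded_linear_compose[OF bounded_linear_cnj])+

section \<open>The forms in the left-invariant frame\<close>

definition diag :: "('n set \<Rightarrow> complex) \<Rightarrow> 'n covec" where
  "diag f = (\<lambda>I J. if I = J then f I else 0)"

text \<open>With \<open>k = 1\<close> and \<open>c = \<i>\<close> this is the diagonal (1,1)-form
  with weights \<open>w\<close>; its powers stay in this family, so they are tracked by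
  \<open>k\<close> and \<open>c\<close> alone.\<close>

definition pow_diag :: "nat \<Rightarrow> complex \<Rightarrow> ('n \<Rightarrow> complex) \<Rightarrow> 'n covec" where
  "pow_diag k c w = diag (\<lambda>I. if card I = k then c * prod w I else 0)"

lemma pow_diag_Lam: "pow_diag k c w \<in> Lam k k"
  by (auto simp: pow_diag_def diag_def Lam_def)

lemma cscale_pow_diag: "cscale d (pow_diag k c w) = pow_diag k (d * c) w"
  by (auto simp: pow_diag_def diag_def cscale_def fun_eq_iff)

text \<open>A set \<open>I\<close> of size \<open>Suc k\<close> arises from \<open>Suc k\<close>
  choices of the split-off index \<open>i\<close>. All contribute equally: the holomorphic and
  antiholomorphic shuffle signs coincide and cancel, leaving \<open>(-1) ^ k\<close> from moving
  \<open>dzbar_i\<close> past \<open>k\<close> factors.\<close>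

lemma wedge_pow_diag:
  fixes w :: "'n::{finite,linorder} \<Rightarrow> complex"
  shows "wedge (pow_diag 1 \<i> w) (pow_diag k c w) = pow_diag (Suc k) ((-1) ^ k * \<i> * of_nat (Suc k) * c) w"
proof (intro ext)
  fix I J :: "'n set"
  have s: "sgn_below i B * sgn_below i B = 1" for i and B :: "'n set"
    by (simp add: sgn_below_def flip: power_add)
  have "wedge (pow_diag 1 \<i> w) (pow_diag k c w) I J =
    (\<Sum>i\<in>I. \<Sum>j\<in>J. if j = i then (-1) ^ (card I - 1) * (\<i> * w i) * pow_diag k c w (I - {i}) (J - {i}) else 0)"
    unfolding wedge_11[OF pow_diag_Lam]
  proof (intro sum.cong refl)
    fix i j
    let ?p = "pow_diag k c w (I - {i}) (J - {i})"
    have "sgn_below i (I - {i}) * sgn_below i (J - {i}) * ?p = ?p"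
      using s[of i "I - {i}"] by (cases "I - {i} = J - {i}") (simp_all add: pow_diag_def diag_def)
    then have "(-1) ^ (card I - 1) * (\<i> * w i) * (sgn_below i (I - {i}) * sgn_below i (J - {i}) * ?p)
        = (-1) ^ (card I - 1) * (\<i> * w i) * ?p"
      by (simp only:)
    then show "(-1) ^ (card I - 1) * sgn_below i (I - {i}) * sgn_below j (J - {j}) *
        pow_diag 1 \<i> w {i} {j} * pow_diag k c w (I - {i}) (J - {j})
      = (if j = i then (-1) ^ (card I - 1) * (\<i> * w i) * ?p else 0)"
      by (cases "j = i") (simp_all only: mult_ac, simp_all add: pow_diag_def diag_def)
  qed
  also have "\<dots> = (\<Sum>i\<in>I. if i \<in> J then (-1) ^ (card I - 1) * (\<i> * w i) * pow_diag k c w (I - {i}) (J - {i}) else 0)"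
    by (intro sum.cong refl) simp
  also have "\<dots> = (\<Sum>i\<in>I. if I = J \<and> card I = Suc k then (-1) ^ k * \<i> * c * prod w I else 0)"
  proof (intro sum.cong refl)
    fix i assume i: "i \<in> I"
    have c: "card I = Suc (card (I - {i}))"
      using i by (metis card_Suc_Diff1 finite)
    have p: "w i * prod w (I - {i}) = prod w I"
      using i by (simp add: prod.remove)
    show "(if i \<in> J then (-1) ^ (card I - 1) * (\<i> * w i) * pow_diag k c w (I - {i}) (J - {i}) else 0)
      = (if I = J \<and> card I = Suc k then (-1) ^ k * \<i> * c * prod w I else 0)"
    proof (cases "I = J")
      case True
      then show ?thesis
        unfolding c pow_diag_def diag_def p[symmetric] using i by simp
    next
      case False
      then have "i \<in> J \<Longrightarrow> I - {i} \<noteq> J - {i}" using i by blast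
      then show ?thesis using False by (simp add: pow_diag_def diag_def)
    qed
  qed
  also have "\<dots> = pow_diag (Suc k) ((-1) ^ k * \<i> * of_nat (Suc k) * c) w I J"
    by (auto simp: pow_diag_def diag_def)
  finally show "wedge (pow_diag 1 \<i> w) (pow_diag k c w) I J =
     pow_diag (Suc k) ((-1) ^ k * \<i> * of_nat (Suc k) * c) w I J" .
qed

lemma cone_pow_diag: "cone = pow_diag 0 1 w" for w :: "'n::finite \<Rightarrow> complex"
  by (auto simp: cone_def pow_diag_def diag_def fun_eq_iff)

lemma wedge_power_0 [simp]: "wedge_power \<alpha> 0 = cone"
  by (simp add: wedge_power_def wedge_list_def)

lemma wedge_power_Suc [simp]: "wedge_power \<alpha> (Suc k) = wedge \<alpha> (wedge_power \<alpha> k)"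
  by (simp add: wedge_power_def wedge_list_def)

lemma cscale_cscale: "cscale c (cscale d \<alpha>) = cscale (c * d) \<alpha>"
  by (simp add: cscale_def mult_ac)

lemma wedge_power_cscale: "wedge_power (cscale c \<alpha>) k = cscale (c ^ k) (wedge_power \<alpha> k)"
proof (induction k)
  case 0
  show ?case by (simp add: cscale_def)
next
  case (Suc k)
  then show ?case by (simp add: wedge_cscale_left wedge_cscale_right cscale_cscale mult.commute)
qed

lemma wedge_power_shear: "wedge_power (shear t \<alpha>) k = shear t (wedge_power \<alpha> k)"
  by (simp add: wedge_power_def shear_wedge_list)

definition weight :: "complex \<Rightarrow> 4 \<Rightarrow> complex" where
  "weight s j = (if j = 3 then 1 / s else 1)"

definition omega0 :: "complex \<Rightarrow> 4 covec" where
  "omega0 z = pow_diag 1 \<i> (weight (1 + z * cnj z))"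

text \<open>The form \<open>X\<close>. As \<open>4\<close> is the least index, \<open>{3, 4}\<close>
  denotes \<open>dz_4 \<and> dz_3\<close>; with the factors in the order 3, 4 the coefficients are
  \<open>z\<close> and \<open>cnj z\<close>.\<close>

definition cross :: "complex \<Rightarrow> 4 covec" where
  "cross z = (\<lambda>I J. if I = {1, 2} \<and> J = {3, 4} then - z
     else if I = {3, 4} \<and> J = {1, 2} then - cnj z else 0)"

text \<open>For \<open>w\<close> the weights of \<omega>, \<open>pow_diag 2 1 w\<close> is half the
  square of \<omega>, because \<open>(-1) * \<i> * 2 * \<i> = 2\<close> in
  \<open>wedge_pow_diag\<close>.\<close>

definition Omega0 :: "complex \<Rightarrow> 4 covec" where
  "Omega0 z = cadd (pow_diag 2 (1 + z * cnj z) (weight (1 + z * cnj z))) (cross z)"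

lemma sq1_ne_0: "1 + z * cnj z \<noteq> 0"
  unfolding of_real_sq1[symmetric] using sq1_pos[of z] by (metis less_irrefl of_real_eq_0_iff)

lemma set_4_neq:
  "{1, 2} \<noteq> {3, 4 :: 4}" "{3, 4} \<noteq> {1, 2 :: 4}"
  by (simp_all add: set_eq_iff forall_4)

lemma cross_Lam: "cross z \<in> Lam 2 2"
  by (auto simp: cross_def Lam_def)

text \<open>A diagonal form removes the same index \<open>i\<close> from \<open>I\<close> and
  \<open>J\<close>. What is left would have to be \<open>{1, 2}\<close> and \<open>{3, 4}\<close> in
  some order, but one of these sets contains \<open>i\<close>.\<close>

lemma wedge_omega0_cross: "wedge (omega0 z) (cross z) = czero"
proof (intro ext)
  fix I J
  have "cross z (I - {i}) (J - {i}) = 0" if "i \<in> I" "i \<in> J" for i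
  proof (rule ccontr)
    assume "cross z (I - {i}) (J - {i}) \<noteq> 0"
    then have "I - {i} = {1, 2} \<and> J - {i} = {3, 4} \<or> I - {i} = {3, 4} \<and> J - {i} = {1, 2}"
      by (simp add: cross_def split: if_splits)
    moreover have "i \<in> {1, 2} \<union> {3, 4}" using exhaust_4[of i] by blast
    ultimately show False by blast
  qed
  then have "omega0 z {i} {j} * cross z (I - {i}) (J - {j}) = 0" if "i \<in> I" "j \<in> J" for i j
    using that by (cases "i = j") (auto simp: omega0_def pow_diag_def diag_def)
  then show "wedge (omega0 z) (cross z) I J = czero I J"
    using wedge_11[OF pow_diag_Lam, of \<i> "weight (1 + z * cnj z)" "cross z" I J]
    by (auto simp: omega0_def[symmetric] czero_def mult.assoc simp del: One_nat_def intro!: sum.neutral)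
qed

lemma wedge_omega0_Omega0:
  "wedge (omega0 z) (Omega0 z) = pow_diag 3 (3 * \<i> * (1 + z * cnj z)) (weight (1 + z * cnj z))"
  unfolding Omega0_def wedge_cadd_right wedge_omega0_cross
  unfolding omega0_def wedge_pow_diag
  by (simp add: numeral_3_eq_3 cadd_def czero_def mult_ac)

lemma wedge_power_omega0:
  "wedge_power (omega0 z) 3 = pow_diag 3 (6 * \<i>) (weight (1 + z * cnj z))"
  unfolding omega0_def numeral_3_eq_3 wedge_power_Suc wedge_power_0
    cone_pow_diag[of "weight (1 + z * cnj z)"] wedge_pow_diag
  by simp

lemma omega0_Lam: "omega0 z \<in> Lam 1 1"
  unfolding omega0_def by (rule pow_diag_Lam)

lemma Lam_cadd:
  assumes "\<alpha> \<in> Lam p q" "\<beta> \<in> Lam p q"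
  shows "cadd \<alpha> \<beta> \<in> Lam p q"
proof -
  have "card I = p \<and> card J = q" if "\<alpha> I J + \<beta> I J \<noteq> 0" for I J
  proof -
    from that have "\<alpha> I J \<noteq> 0 \<or> \<beta> I J \<noteq> 0" by auto
    then show ?thesis using assms unfolding Lam_def by blast
  qed
  then show ?thesis unfolding Lam_def cadd_def by blast
qed

lemma Omega0_Lam: "Omega0 z \<in> Lam 2 2"
  unfolding Omega0_def by (intro Lam_cadd pow_diag_Lam cross_Lam)

lemma conj_pow_diag:
  assumes "\<And>j. cnj (w j) = w j" "(-1) ^ k * cnj c = c"
  shows "conj_covec (pow_diag k c w) = pow_diag k c w"
proof (intro ext)
  fix I J
  have e: "(-1) ^ (k * k) = ((-1) ^ k :: complex)"
    by (simp add: minus_one_power_iff)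
  have "cnj (prod w J) = prod w J" by (simp add: assms(1))
  then show "conj_covec (pow_diag k c w) I J = pow_diag k c w I J"
    using assms(2) by (cases "I = J \<and> card I = k")
      (auto simp: conj_covec_def pow_diag_def diag_def e simp flip: mult.assoc)
qed

lemma cnj_weight: "cnj (weight (1 + z * cnj z) j) = weight (1 + z * cnj z) j"
  by (simp add: weight_def mult.commute)

lemma conj_omega0: "conj_covec (omega0 z) = omega0 z"
  unfolding omega0_def by (rule conj_pow_diag[OF cnj_weight]) simp

lemma conj_covec_cadd: "conj_covec (cadd \<alpha> \<beta>) = cadd (conj_covec \<alpha>) (conj_covec \<beta>)"
  by (simp add: conj_covec_def cadd_def fun_eq_iff distrib_left)

lemma conj_cross: "conj_covec (cross z) = cross z"
  by (auto simp: conj_covec_def cross_def fun_eq_iff set_4_neq)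

lemma conj_Omega0: "conj_covec (Omega0 z) = Omega0 z"
  unfolding Omega0_def conj_covec_cadd conj_cross
  by (subst conj_pow_diag[OF cnj_weight]) (simp_all add: mult.commute)

section \<open>Closedness\<close>

lemma prod_weight:
  "prod (weight s) I = (if 3 \<in> I then 1 / s else 1)"
proof -
  have "prod (weight s) (I - {3}) = 1"
    by (rule prod.neutral) (simp add: weight_def)
  then show ?thesis
    by (cases "3 \<in> I") (simp_all add: prod.remove weight_def)
qed

text \<open>The factor \<open>s\<close> cancels the denominator coming from index 3. The
  coefficients become polynomial in \<open>z_4\<close> and its conjugate, and those at sets
  containing 3 are constant.\<close>

lemma pow_diag_weight:
  assumes "s \<noteq> 0"
  shows "pow_diag k (c * s) (weight s) I J =
    (if I = J \<and> card I = k then if 3 \<in> I then c else c * s else 0)"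
  using assms by (auto simp: pow_diag_def diag_def prod_weight)

lemma has_wirtinger_sq1:
  "has_wirtinger (\<lambda>y::4 cspace. c * (1 + y $ 4 * cnj (y $ 4)))
    (\<lambda>j. if j = 4 then c * cnj (x $ 4) else 0) (\<lambda>j. if j = 4 then c * x $ 4 else 0) x"
  by (rule has_wirtinger_cong[OF has_wirtinger_mult[OF has_wirtinger_const[of c]
     has_wirtinger_add[OF has_wirtinger_const[of 1]
       has_wirtinger_mult[OF has_wirtinger_coord[of 4] has_wirtinger_cnj[OF has_wirtinger_coord[of 4]]]]]])
    auto

lemma has_wirtinger_pow_diag_weight:
  "has_wirtinger (\<lambda>y::4 cspace. pow_diag k (c * (1 + y $ 4 * cnj (y $ 4))) (weight (1 + y $ 4 * cnj (y $ 4))) I J)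
    (\<lambda>j. if j = 4 then if I = J \<and> card I = k \<and> 3 \<notin> I then c * cnj (x $ 4) else 0 else 0)
    (\<lambda>j. if j = 4 then if I = J \<and> card I = k \<and> 3 \<notin> I then c * x $ 4 else 0 else 0) x"
proof (cases "I = J \<and> card I = k \<and> 3 \<notin> I")
  case True
  then show ?thesis
    by (intro has_wirtinger_cong[OF has_wirtinger_sq1[of c x]]) (auto simp: pow_diag_weight[OF sq1_ne_0])
next
  case False
  then have "pow_diag k (c * (1 + y $ 4 * cnj (y $ 4))) (weight (1 + y $ 4 * cnj (y $ 4))) I J
      = (if I = J \<and> card I = k then c else 0)" for y :: "4 cspace"
    by (auto simp: pow_diag_weight[OF sq1_ne_0])
  then show ?thesis using False
    by (intro has_wirtinger_cong[OF has_wirtinger_const]) auto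
qed

lemma has_wirtinger_cross:
  "has_wirtinger (\<lambda>y::4 cspace. cross (y $ 4) I J)
    (\<lambda>j. if j = 4 then if I = {1, 2} \<and> J = {3, 4} then -1 else 0 else 0)
    (\<lambda>j. if j = 4 then if I = {3, 4} \<and> J = {1, 2} then -1 else 0 else 0) x"
proof -
  note n = has_wirtinger_mult[OF has_wirtinger_const[of "-1"] has_wirtinger_coord[of 4 x]]
    has_wirtinger_mult[OF has_wirtinger_const[of "-1"] has_wirtinger_cnj[OF has_wirtinger_coord[of 4 x]]]
  consider "I = {1, 2} \<and> J = {3, 4}" | "I = {3, 4} \<and> J = {1, 2}"
    | "\<not> (I = {1, 2} \<and> J = {3, 4})" "\<not> (I = {3, 4} \<and> J = {1, 2})" by blast
  then show ?thesis
  proof cases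
    case 1
    then show ?thesis
      by (intro has_wirtinger_cong[OF n(1)]) (simp_all add: cross_def set_4_neq)
  next
    case 2
    then show ?thesis
      by (intro has_wirtinger_cong[OF n(2)]) (simp_all add: cross_def set_4_neq)
  next
    case 3
    then show ?thesis
      by (intro has_wirtinger_cong[OF has_wirtinger_const[of 0]]) (simp_all only: cross_def if_False if_cancel)
  qed
qed

lemma closed_left_inv_pow_diag_3:
  "closed_form (sheared_form (\<lambda>z. pow_diag 3 (c * (1 + z * cnj z)) (weight (1 + z * cnj z))))"
  unfolding closed_form_def
proof
  fix x :: "4 cspace"
  \<comment> \<open>Only the coefficient at \<open>{1, 2, 4}\<close> varies with \<open>z_4\<close>,
    and it is annihilated by a further factor \<open>dz_4\<close> or \<open>dzbar_4\<close>.\<close>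
  have n: "\<not> (card (I - {4}) = 3 \<and> 3 \<notin> I - {4})" for I :: "4 set"
    using set_4_cases[of I] by (elim insertE emptyE; simp)
  \<comment> \<open>The structure-equation terms vanish for lack of indices: once 1 and 2 are
    removed, only 3 and 4 can remain.\<close>
  have n': "card (insert 3 (I - {1} - {2})) \<noteq> 3" if "1 \<in> I" "2 \<in> I" "3 \<notin> I" for I :: "4 set"
    using that set_4_cases[of I] by (elim insertE emptyE; simp)
  let ?s = "1 + x $ 4 * cnj (x $ 4)"
  let ?P = "pow_diag 3 (c * ?s) (weight ?s)"
  let ?A = "\<lambda>b I J. if I = J \<and> card I = 3 \<and> 3 \<notin> I then b else (0 :: complex)"
  have "wedge (dz 4) (?A b) I J = 0" "wedge (dzbar 4) (?A b) I J = 0" for b and I J :: "4 set"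
  proof -
    have "?A b (I - {4}) J = 0" "?A b I (J - {4}) = 0"
      by (rule if_not_P; use n in blast)+
    then show "wedge (dz 4) (?A b) I J = 0" "wedge (dzbar 4) (?A b) I J = 0"
      by (simp_all only: wedge_dz wedge_dzbar mult_zero_right if_cancel)
  qed
  moreover have "replace_hol ?P (I - {1}) J = 0" if "1 \<in> I" for I J
    using n'[OF that] by (auto simp: replace_hol_def pow_diag_def diag_def)
  moreover have "replace_anti ?P I (J - {1}) = 0" if "1 \<in> J" for I J
    using n'[OF that] by (auto simp: replace_anti_def pow_diag_def diag_def)
  ultimately have "cadd (cadd (wedge (dz 4) (?A (c * cnj (x $ 4)))) (wedge (dzbar 4) (?A (c * x $ 4))))
      (cscale (-1) (cadd (wedge (dz 1) (replace_hol ?P)) (wedge (dzbar 1) (replace_anti ?P)))) = czero"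
    by (intro ext) (simp add: cadd_def cscale_def czero_def wedge_dz[of 1] wedge_dzbar[of 1])
  then show "ext_deriv (sheared_form (\<lambda>z. pow_diag 3 (c * (1 + z * cnj z)) (weight (1 + z * cnj z)))) x = czero"
    by (subst ext_deriv_sheared_form[OF has_wirtinger_pow_diag_weight]) simp
qed

lemma Omega0_apply:
  "Omega0 z I J = (if I = J \<and> card I = 2 then if 3 \<in> I then 1 else 1 + z * cnj z else 0) + cross z I J"
  using pow_diag_weight[OF sq1_ne_0[of z], of 2 1 I J] unfolding Omega0_def cadd_def by (simp only: mult_1)

lemma closed_left_inv_Omega0: "closed_form (sheared_form Omega0)"
  unfolding closed_form_def
proof
  fix x :: "4 cspace"
  let ?z = "x $ 4"
  define A1 where "A1 = (\<lambda>I J. (if I = J \<and> card I = 2 \<and> 3 \<notin> I then cnj ?z else 0)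
    + (if I = {1, 2} \<and> J = {3, 4::4} then -1 else 0))"
  define A2 where "A2 = (\<lambda>I J. (if I = J \<and> card I = 2 \<and> 3 \<notin> I then ?z else 0)
    + (if I = {3, 4} \<and> J = {1, 2::4} then -1 else 0))"
  have w: "has_wirtinger (\<lambda>y. Omega0 (y $ 4) I J) (\<lambda>j. if j = 4 then A1 I J else 0)
      (\<lambda>j. if j = 4 then A2 I J else 0) x" for I J
    using has_wirtinger_add[OF has_wirtinger_pow_diag_weight[of 2 1 I J x] has_wirtinger_cross[of I J x]]
    by (rule has_wirtinger_cong) (auto simp: Omega0_def cadd_def A1_def A2_def)
  have ne: "{1, 3} \<noteq> {1, 2 :: 4}" "{2, 3} \<noteq> {1, 2 :: 4}" "{1, 2, 3} \<noteq> {1, 2 :: 4}"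
    by (simp_all add: set_eq_iff forall_4)
  \<comment> \<open>Both sides live at \<open>I = {1, 2, 4}\<close>. For \<open>J = {1, 2}\<close>
    the derivative of \<open>u\<close> meets the cross coefficient \<open>- cnj z\<close>; for
    \<open>J = {3, 4}\<close> the derivative \<open>-1\<close> of the cross term meets the
    coefficient 1 of \<open>Omega0\<close>, the sign coming from moving \<open>dz_1\<close> past
    \<open>dz_4\<close>.\<close>
  have 1: "wedge (dz 4) A1 I J = wedge (dz 1) (replace_hol (Omega0 ?z)) I J" for I J
    using set_4_cases[of I]
    by (elim insertE emptyE; hypsubst;
        auto simp: wedge_dz replace_hol_def A1_def Omega0_apply cross_def set_4_neq ne insert_commute)
  have 2: "wedge (dzbar 4) A2 I J = wedge (dzbar 1) (replace_anti (Omega0 ?z)) I J" for I J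
    using set_4_cases[of J]
    by (elim insertE emptyE; hypsubst;
        auto simp: wedge_dzbar replace_anti_def A2_def Omega0_apply cross_def set_4_neq ne insert_commute)
  have "cadd (cadd (wedge (dz 4) A1) (wedge (dzbar 4) A2))
      (cscale (-1) (cadd (wedge (dz 1) (replace_hol (Omega0 ?z)))
         (wedge (dzbar 1) (replace_anti (Omega0 ?z))))) = czero"
    by (intro ext) (simp add: cadd_def cscale_def czero_def 1 2)
  then show "ext_deriv (sheared_form Omega0) x = czero"
    by (simp add: ext_deriv_sheared_form[of Omega0 A1 A2, OF w])
qed

section \<open>Positivity of the volume form\<close>

definition minor2 :: "('a \<Rightarrow> 'a \<Rightarrow> complex) \<Rightarrow> 'a \<Rightarrow> 'a \<Rightarrow> 'a \<Rightarrow> 'a \<Rightarrow> complex" where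
  "minor2 H a b d e = H a d * H b e - H a e * H b d"

definition minor3 :: "('a \<Rightarrow> 'a \<Rightarrow> complex) \<Rightarrow> 'a \<Rightarrow> 'a \<Rightarrow> 'a \<Rightarrow> 'a \<Rightarrow> 'a \<Rightarrow> 'a \<Rightarrow> complex" where
  "minor3 H a b c d e f = H a d * minor2 H b c e f - H a e * minor2 H b c d f + H a f * minor2 H b c d e"

definition minor4 :: "('a \<Rightarrow> 'a \<Rightarrow> complex) \<Rightarrow> 'a \<Rightarrow> 'a \<Rightarrow> 'a \<Rightarrow> 'a \<Rightarrow> complex" where
  "minor4 H a b c d = - H a d * minor3 H b c d a b c + H b d * minor3 H a c d a b c
     - H c d * minor3 H a b d a b c + H d d * minor3 H a b c a b c"

text \<open>This passes positivity from one leading principal minor to the next.\<close>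

lemma pos_if_real:
  assumes "0 < Re (x * cnj y)" "0 < Re y" "Im x = 0" "Im y = 0"
  shows "0 < Re x"
  using assms by (simp add: zero_less_mult_iff)

text \<open>For the vector \<open>v\<close> of cofactors of the last column, the quadratic form takes the value
  \<open>D_k cnj D_(k-1)\<close> on \<open>v\<close>, where \<open>D_k\<close> are the leading principal minors.\<close>

lemma minor4_pos:
  assumes herm: "\<And>i j. cnj (H i j) = H j i"
    and pos: "\<And>x y z w. x \<noteq> 0 \<or> y \<noteq> 0 \<or> z \<noteq> 0 \<or> w \<noteq> 0 \<Longrightarrow>
      0 < Re ((H a a * x + H b a * y + H c a * z + H d a * w) * cnj x
            + (H a b * x + H b b * y + H c b * z + H d b * w) * cnj y
            + (H a c * x + H b c * y + H c c * z + H d c * w) * cnj z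
            + (H a d * x + H b d * y + H c d * z + H d d * w) * cnj w)"
  shows "Im (minor4 H a b c d) = 0" "0 < Re (minor4 H a b c d)"
proof -
  have real: "Im x = 0" if "cnj x = x" for x
    using that by (simp add: complex_eq_iff)
  have i1: "Im (H a a) = 0"
    by (rule real) (simp add: herm)
  have i2: "Im (minor2 H a b a b) = 0"
    by (rule real) (simp add: herm minor2_def algebra_simps)
  have i3: "Im (minor3 H a b c a b c) = 0"
    by (rule real) (simp add: herm minor3_def minor2_def algebra_simps)
  show i4: "Im (minor4 H a b c d) = 0"
    by (rule real) (simp add: herm minor4_def minor3_def minor2_def algebra_simps)
  have p1: "0 < Re (H a a)"
    using pos[of 1 0 0 0] by simp
  have z2: "H a a * (- H b a) + H b a * H a a = 0" "H a b * (- H b a) + H b b * H a a = minor2 H a b a b"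
    by (simp_all add: minor2_def algebra_simps)
  have p2: "0 < Re (minor2 H a b a b)"
  proof (rule pos_if_real[OF _ p1 i2 i1])
    show "0 < Re (minor2 H a b a b * cnj (H a a))"
      using pos[of "- H b a" "H a a" 0 0] p1 unfolding mult_zero_right add_0_right z2
      by (cases "H a a = 0") auto
  qed
  have p3: "0 < Re (minor3 H a b c a b c)"
  proof (rule pos_if_real[OF _ p2 i3 i2])
    have "H a a * minor2 H b c a b + H b a * (- minor2 H a c a b) + H c a * minor2 H a b a b = 0"
      "H a b * minor2 H b c a b + H b b * (- minor2 H a c a b) + H c b * minor2 H a b a b = 0"
      "H a c * minor2 H b c a b + H b c * (- minor2 H a c a b) + H c c * minor2 H a b a b = minor3 H a b c a b c"
      by (simp_all add: minor3_def minor2_def algebra_simps)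
    then show "0 < Re (minor3 H a b c a b c * cnj (minor2 H a b a b))"
      using pos[of "minor2 H b c a b" "- minor2 H a c a b" "minor2 H a b a b" 0] p2 by (cases "minor2 H a b a b = 0") auto
  qed
  show "0 < Re (minor4 H a b c d)"
  proof (rule pos_if_real[OF _ p3 i4 i3])
    let ?x = "- minor3 H b c d a b c" and ?y = "minor3 H a c d a b c"
    let ?z = "- minor3 H a b d a b c" and ?w = "minor3 H a b c a b c"
    have "H a a * ?x + H b a * ?y + H c a * ?z + H d a * ?w = 0"
      "H a b * ?x + H b b * ?y + H c b * ?z + H d b * ?w = 0"
      "H a c * ?x + H b c * ?y + H c c * ?z + H d c * ?w = 0"
      "H a d * ?x + H b d * ?y + H c d * ?z + H d d * ?w = minor4 H a b c d"
      by (simp_all add: minor4_def minor3_def minor2_def algebra_simps)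
    then show "0 < Re (minor4 H a b c d * cnj ?w)"
      using pos[of ?x ?y ?z ?w] p3 by (cases "?w = 0") auto
  qed
qed

text \<open>The coefficients of the k-th power are the k-by-k minors times \<open>k!\<close> and the
  sign \<open>(-1)^(k(k-1)/2)\<close> of sorting holomorphic before conjugate factors. This gives
  the constants -2, -6 and 24 here and in the next two lemmas.\<close>

lemma wedge_power_11_2:
  assumes g: "g \<in> Lam 1 1" and "a < b" "d < e"
  shows "wedge_power g 2 {a, b} {d, e} = -2 * minor2 (\<lambda>i j. g {i} {j}) a b d e"
proof -
  have "{a, b} - {a} = {b}" "{a, b} - {b} = {a}" "{d, e} - {d} = {e}" "{d, e} - {e} = {d}"
    "a \<noteq> b" "d \<noteq> e" "\<not> b < a" "\<not> e < d"
    using assms by auto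
  then show ?thesis using assms
    unfolding numeral_2_eq_2 wedge_power_Suc wedge_11[OF g]
    by (simp add: cone_def minor2_def)
qed

lemma wedge_power_11_3:
  assumes g: "g \<in> Lam 1 1" and "a < b" "b < c" "d < e" "e < f"
  shows "wedge_power g 3 {a, b, c} {d, e, f} = -6 * minor3 (\<lambda>i j. g {i} {j}) a b c d e f"
proof -
  have s: "{a, b, c} - {a} = {b, c}" "{a, b, c} - {b} = {a, c}" "{a, b, c} - {c} = {a, b}"
    "{d, e, f} - {d} = {e, f}" "{d, e, f} - {e} = {d, f}" "{d, e, f} - {f} = {d, e}"
    "a \<noteq> b" "d \<noteq> e" "a \<noteq> c" "d \<noteq> f" "b \<noteq> c" "e \<noteq> f" "\<not> b < a" "\<not> e < d"
    "\<not> c < a" "\<not> f < d" "\<not> c < b" "\<not> f < e" "a < c" "d < f"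
    using assms by auto
  have "wedge_power g 3 {a, b, c} {d, e, f} = wedge g (wedge_power g 2) {a, b, c} {d, e, f}"
    by (simp add: eval_nat_numeral)
  also have "\<dots> = -6 * minor3 (\<lambda>i j. g {i} {j}) a b c d e f"
    using assms(2-) s
    by (simp add: wedge_11[OF g] wedge_power_11_2[OF g] minor3_def) (simp add: minor2_def algebra_simps)
  finally show ?thesis .
qed

lemma wedge_power_11_4:
  fixes g :: "4 covec"
  assumes g: "g \<in> Lam 1 1"
  shows "wedge_power g 4 UNIV UNIV = 24 * minor4 (\<lambda>i j. g {i} {j}) 4 1 2 3"
proof -
  \<comment> \<open>The indices are listed in increasing order, as the expansion into smaller minors
    requires.\<close>
  have U: "UNIV = {4, 1, 2, 3 :: 4}" using UNIV_4 by auto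
  have "wedge_power g 4 UNIV UNIV = wedge g (wedge_power g 3) UNIV UNIV"
    by (simp add: eval_nat_numeral)
  also have "\<dots> = 24 * minor4 (\<lambda>i j. g {i} {j}) 4 1 2 3"
    unfolding U
    by (simp add: wedge_11[OF g] wedge_power_11_3[OF g] minor4_def)
       (simp add: minor3_def minor2_def algebra_simps)
  finally show ?thesis .
qed

text \<open>The Hodge star divides by this coefficient, so its positivity reduces the sign of
  \<open>HR_form\<close> to that of a top coefficient. Passing from \<open>g\<close> to the positive
  definite matrix \<open>H\<close> costs the factor \<open>\<i> ^ 4 = 1\<close>.\<close>

lemma volume_pos:
  assumes "hermitian_metric_on G (g :: 4 cform)"
  shows "Im (volume (g x) UNIV UNIV) = 0" "0 < Re (volume (g x) UNIV UNIV)"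
proof -
  define H where "H = (\<lambda>i j. - \<i> * g x {i} {j})"
  have L: "g x \<in> Lam 1 1" and c: "conj_covec (g x) = g x" and pos: "positive_11 g"
    using assms by (auto simp: hermitian_metric_on_def has_type_def real_form_def)
  have "volume (g x) UNIV UNIV = minor4 (\<lambda>i j. g x {i} {j}) 4 1 2 3"
    using wedge_power_11_4[OF L] by (simp add: volume_def cscale_def fact_numeral)
  also have "(\<lambda>i j. g x {i} {j}) = (\<lambda>i j. \<i> * H i j)"
    by (simp add: H_def fun_eq_iff)
  also have "minor4 (\<lambda>i j. \<i> * H i j) 4 1 2 3 = minor4 H 4 1 2 3"
    by (simp add: minor4_def minor3_def minor2_def algebra_simps)
  finally have v: "volume (g x) UNIV UNIV = minor4 H 4 1 2 3" .
  have herm: "cnj (H i j) = H j i" for i j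
  proof -
    have "g x {j} {i} = - cnj (g x {i} {j})"
      using fun_cong[OF fun_cong[OF c], of "{j}" "{i}"] by (simp add: conj_covec_def)
    then show ?thesis by (simp add: H_def)
  qed
  have "0 < Re ((H 4 4 * a + H 1 4 * b + H 2 4 * c + H 3 4 * d) * cnj a
            + (H 4 1 * a + H 1 1 * b + H 2 1 * c + H 3 1 * d) * cnj b
            + (H 4 2 * a + H 1 2 * b + H 2 2 * c + H 3 2 * d) * cnj c
            + (H 4 3 * a + H 1 3 * b + H 2 3 * c + H 3 3 * d) * cnj d)" (is "0 < Re ?s")
    if "a \<noteq> 0 \<or> b \<noteq> 0 \<or> c \<noteq> 0 \<or> d \<noteq> 0" for a b c d
  proof -
    let ?v = "vector [b, c, d, a] :: complex ^ 4"
    have "?v \<noteq> 0"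
      using that by (simp add: vec_eq_iff forall_4) blast
    then have "0 < Re (\<Sum>j\<in>UNIV. \<Sum>k\<in>UNIV. H j k * ?v $ j * cnj (?v $ k))"
      using pos unfolding positive_11_def H_def by blast
    also have "(\<Sum>j\<in>UNIV. \<Sum>k\<in>UNIV. H j k * ?v $ j * cnj (?v $ k)) = ?s"
      unfolding sum_4 vector_4_nth by (simp only: distrib_right add_ac)
    finally show ?thesis .
  qed
  then show "Im (volume (g x) UNIV UNIV) = 0" "0 < Re (volume (g x) UNIV UNIV)"
    unfolding v using minor4_pos[of H 4 1 2 3, OF herm] by blast+
qed

section \<open>The Hodge-Riemann property\<close>

lemma wedge_czero_left [simp]: "wedge czero \<alpha> = czero"
  by (simp add: wedge_def czero_def)

lemma wedge_czero_right [simp]: "wedge \<alpha> czero = czero"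
  by (simp add: wedge_def czero_def)

lemma conj_czero [simp]: "conj_covec czero = czero"
  by (simp add: conj_covec_def czero_def)

lemma cadd_czero [simp]: "cadd czero \<alpha> = \<alpha>" "cadd \<alpha> czero = \<alpha>"
  by (simp_all add: cadd_def czero_def)

lemma Lam_conj: "\<alpha> \<in> Lam p q \<Longrightarrow> conj_covec \<alpha> \<in> Lam q p"
  by (auto simp: Lam_def conj_covec_def)

lemma czero_Lam [simp]: "czero \<in> Lam p q"
  by (simp add: Lam_def czero_def)

section \<open>Invariance of the Hodge-Riemann property under the shear\<close>

lemma HR_form_shear: "HR_form g (shear t \<Omega>) p q (shear t \<alpha>) (shear t \<beta>) = HR_form g \<Omega> p q \<alpha> \<beta>"
  by (simp add: HR_form_def star_top_def conj_shear flip: shear_wedge)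

lemma shear_image_Lam: "shear t ` Lam p q = Lam p q"
proof
  show "Lam p q \<subseteq> shear t ` Lam p q"
  proof
    fix \<alpha> :: "4 covec" assume "\<alpha> \<in> Lam p q"
    then have "shear (- t) \<alpha> \<in> Lam p q" "\<alpha> = shear t (shear (- t) \<alpha>)"
      by (simp_all add: shear_Lam shear_shear)
    then show "\<alpha> \<in> shear t ` Lam p q" by blast
  qed
qed (auto intro: shear_Lam)

lemma primitive_shear: "primitive (shear t \<omega>) (shear t \<Omega>) p q = shear t ` primitive \<omega> \<Omega> p q"
proof -
  have "wedge (wedge (shear t \<alpha>) (shear t \<omega>)) (shear t \<Omega>) = czero \<longleftrightarrow> wedge (wedge \<alpha> \<omega>) \<Omega> = czero" for \<alpha>
    using shear_eq_iff[of t "wedge (wedge \<alpha> \<omega>) \<Omega>" czero] by (simp add: shear_wedge)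
  moreover have "primitive (shear t \<omega>) (shear t \<Omega>) p q
      = {\<alpha> \<in> shear t ` Lam p q. wedge (wedge \<alpha> (shear t \<omega>)) (shear t \<Omega>) = czero}"
    by (simp add: primitive_def shear_image_Lam)
  ultimately show ?thesis by (auto simp: primitive_def)
qed

lemma lefschetz_image_shear: "lefschetz_image (shear t \<omega>) p q = shear t ` lefschetz_image \<omega> p q"
proof (cases "p = 0 \<or> q = 0")
  case True
  then show ?thesis by (simp add: lefschetz_image_def)
next
  case False
  have "wedge (shear t \<omega>) ` shear t ` Lam (p - 1) (q - 1) = shear t ` wedge \<omega> ` Lam (p - 1) (q - 1)"
    by (simp add: image_image shear_wedge)
  then show ?thesis using False by (simp add: lefschetz_image_def shear_image_Lam)
qed

text \<open>The shear is a multiplicative linear bijection of each \<open>Lam p q\<close> that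
  commutes with conjugation and fixes top coefficients, so every condition transports. It suffices
  to treat \<open>omega0\<close> and \<open>Omega0\<close>.\<close>

lemma hodge_riemann_at_shear:
  assumes "hodge_riemann_at g \<omega> \<Omega> p q"
  shows "hodge_riemann_at g (shear t \<omega>) (shear t \<Omega>) p q"
proof -
  let ?L = "lefschetz_image \<omega> p q" and ?P = "primitive \<omega> \<Omega> p q"
  have ne: "shear t \<alpha> \<noteq> czero \<longleftrightarrow> \<alpha> \<noteq> czero" for \<alpha>
    using shear_eq_iff[of t \<alpha> czero] by simp
  have "{cadd \<eta> \<rho> |\<eta> \<rho>. \<eta> \<in> shear t ` ?L \<and> \<rho> \<in> shear t ` ?P}
      = shear t ` {cadd \<eta> \<rho> |\<eta> \<rho>. \<eta> \<in> ?L \<and> \<rho> \<in> ?P}"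
    by (auto simp: shear_cadd image_iff) (metis shear_cadd)+
  also have "\<dots> = shear t ` Lam p q"
    using assms unfolding hodge_riemann_at_def by metis
  also have "\<dots> = Lam p q" by (rule shear_image_Lam)
  finally have "Lam p q = {cadd \<eta> \<rho> |\<eta> \<rho>. \<eta> \<in> shear t ` ?L \<and> \<rho> \<in> shear t ` ?P}" ..
  moreover have "shear t ` ?L \<inter> shear t ` ?P = shear t ` (?L \<inter> ?P)"
    by (rule image_Int[symmetric]) (simp add: inj_def)
  then have "shear t ` ?L \<inter> shear t ` ?P = {czero}"
    using assms by (simp add: hodge_riemann_at_def)
  ultimately show ?thesis
    using assms unfolding hodge_riemann_at_def primitive_shear lefschetz_image_shear
    by (simp add: HR_form_shear ne)
qed

section \<open>Top coefficients and the degrees (2,0) and (0,2)\<close>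

lemma Lam_eq_0: "\<alpha> \<in> Lam p q \<Longrightarrow> card I \<noteq> p \<or> card J \<noteq> q \<Longrightarrow> \<alpha> I J = 0"
  by (auto simp: Lam_def)

lemma Lam_gt_4:
  fixes \<alpha> :: "4 covec"
  assumes "\<alpha> \<in> Lam p q" "4 < p \<or> 4 < q"
  shows "\<alpha> = czero"
proof (intro ext)
  fix I J :: "4 set"
  have "card A \<le> 4" for A :: "4 set"
    using card_mono[of UNIV A] by simp
  from this[of I] this[of J] have "card I \<noteq> p \<or> card J \<noteq> q" using assms(2) by auto
  then show "\<alpha> I J = czero I J"
    using Lam_eq_0[OF assms(1)] by (simp add: czero_def)
qed

text \<open>The product with \<omega> and \<Omega> would have holomorphic or antiholomorphic degree
  5, which exceeds the dimension.\<close>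

lemma primitive_pure:
  assumes "\<omega> \<in> Lam 1 1" "\<Omega> \<in> Lam 2 2" "p + q = 2" "p = 0 \<or> q = 0"
  shows "primitive \<omega> (\<Omega> :: 4 covec) p q = Lam p q"
proof -
  have "wedge (wedge \<alpha> \<omega>) \<Omega> = czero" if "\<alpha> \<in> Lam p q" for \<alpha>
    by (rule Lam_gt_4[OF Lam_wedge[OF Lam_wedge[OF that assms(1)] assms(2)]]) (use assms in auto)
  then show ?thesis by (auto simp: primitive_def)
qed

lemma hodge_riemann_at_pure:
  assumes "\<omega> \<in> Lam 1 1" "\<Omega> \<in> Lam 2 2" "p + q = 2" "p = 0 \<or> q = 0"
    and "\<And>\<alpha>. \<alpha> \<in> Lam p q \<Longrightarrow> \<alpha> \<noteq> czero \<Longrightarrow> Im (HR_form g \<Omega> p q \<alpha> \<alpha>) = 0 \<and> 0 < Re (HR_form g \<Omega> p q \<alpha> \<alpha>)"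
  shows "hodge_riemann_at g \<omega> (\<Omega> :: 4 covec) p q"
proof -
  have "HR_form g \<Omega> p q czero \<rho> = 0" for \<rho>
    by (simp add: HR_form_def star_top_def) (simp add: czero_def)
  then show ?thesis
    using assms(5) unfolding hodge_riemann_at_def primitive_pure[OF assms(1-4)]
    using assms(4) by (auto simp: lefschetz_image_def)
qed

lemma wedge_frame_UNIV:
  "wedge \<tau> (frame I J) UNIV UNIV = (-1) ^ (card (- J) * card I) *
     shuffle_sign (- I) I * shuffle_sign (- J) J * \<tau> (- I) (- J)"
proof -
  have c: "UNIV - A = I \<longleftrightarrow> A = - I" for A I :: "'a set" by auto
  have "wedge \<tau> (frame I J) UNIV UNIV = (\<Sum>A\<in>UNIV. \<Sum>B\<in>UNIV. if A = - I \<and> B = - J then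
      (-1) ^ (card (- J) * card I) * shuffle_sign (- I) I * shuffle_sign (- J) J * \<tau> (- I) (- J) else 0)"
    unfolding wedge_def Pow_UNIV
    by (intro sum.cong refl) (auto simp: frame_def c)
  also have "\<dots> = (\<Sum>A\<in>UNIV. if A = - I then
      (-1) ^ (card (- J) * card I) * shuffle_sign (- I) I * shuffle_sign (- J) J * \<tau> (- I) (- J) else 0)"
    by (intro sum.cong refl) auto
  finally show ?thesis by simp
qed

lemma pairs_4_neq:
  "{1,2} \<noteq> {1,3::4}" "{1,2} \<noteq> {1,4::4}" "{1,2} \<noteq> {2,3::4}" "{1,2} \<noteq> {2,4::4}" "{1,2} \<noteq> {3,4::4}"
  "{1,3} \<noteq> {1,2::4}" "{1,3} \<noteq> {1,4::4}" "{1,3} \<noteq> {2,3::4}" "{1,3} \<noteq> {2,4::4}" "{1,3} \<noteq> {3,4::4}"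
  "{1,4} \<noteq> {1,2::4}" "{1,4} \<noteq> {1,3::4}" "{1,4} \<noteq> {2,3::4}" "{1,4} \<noteq> {2,4::4}" "{1,4} \<noteq> {3,4::4}"
  "{2,3} \<noteq> {1,2::4}" "{2,3} \<noteq> {1,3::4}" "{2,3} \<noteq> {1,4::4}" "{2,3} \<noteq> {2,4::4}" "{2,3} \<noteq> {3,4::4}"
  "{2,4} \<noteq> {1,2::4}" "{2,4} \<noteq> {1,3::4}" "{2,4} \<noteq> {1,4::4}" "{2,4} \<noteq> {2,3::4}" "{2,4} \<noteq> {3,4::4}"
  "{3,4} \<noteq> {1,2::4}" "{3,4} \<noteq> {1,3::4}" "{3,4} \<noteq> {1,4::4}" "{3,4} \<noteq> {2,3::4}" "{3,4} \<noteq> {2,4::4}"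
  by (simp_all add: set_eq_iff forall_4)

lemma Omega0_frame:
  "Omega0 z = cadd (cadd (cadd (frame {3,4} {3,4}) (cscale (1 + z * cnj z) (frame {1,2} {1,2})))
     (cadd (cadd (frame {1,3} {1,3}) (cscale (1 + z * cnj z) (frame {2,4} {2,4})))
       (cadd (frame {2,3} {2,3}) (cscale (1 + z * cnj z) (frame {1,4} {1,4})))))
     (cadd (cscale (- z) (frame {1,2} {3,4})) (cscale (- cnj z) (frame {3,4} {1,2})))"
proof (intro ext)
  fix I J
  have "cross z I J = cadd (cscale (- z) (frame {1,2} {3,4})) (cscale (- cnj z) (frame {3,4} {1,2})) I J"
    by (cases "I = {1, 2} \<and> J = {3, 4}"; cases "I = {3, 4} \<and> J = {1, 2}")
      (auto simp: cross_def frame_def cadd_def cscale_def set_4_neq)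
  moreover have "(if I = J \<and> card I = 2 then if 3 \<in> I then 1 else 1 + z * cnj z else 0) =
    cadd (cadd (frame {3,4} {3,4}) (cscale (1 + z * cnj z) (frame {1,2} {1,2})))
     (cadd (cadd (frame {1,3} {1,3}) (cscale (1 + z * cnj z) (frame {2,4} {2,4})))
       (cadd (frame {2,3} {2,3}) (cscale (1 + z * cnj z) (frame {1,4} {1,4})))) I J"
  proof (cases "I = J")
    case True
    show ?thesis
    proof (cases "card J = 2")
      case c: True
      have "J \<in> {{1,2}, {1,3}, {1,4}, {2,3}, {2,4}, {3,4}}"
        using set_4_cases[of J] c by (elim insertE emptyE; hypsubst; simp)
      then show ?thesis
        unfolding True by (elim insertE emptyE) (simp_all add: frame_def cadd_def cscale_def pairs_4_neq)
    next
      case False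
      then have "J \<noteq> {1,2}" "J \<noteq> {1,3}" "J \<noteq> {1,4}" "J \<noteq> {2,3}" "J \<noteq> {2,4}" "J \<noteq> {3,4}"
        by auto
      then show ?thesis
        using False by (simp add: True frame_def cadd_def cscale_def)
    qed
  next
    case False
    then have "frame X X I J = 0" for X by (auto simp: frame_def)
    then show ?thesis using False by (simp add: cadd_def cscale_def)
  qed
  ultimately show "Omega0 z I J = cadd (cadd (cadd (frame {3,4} {3,4}) (cscale (1 + z * cnj z) (frame {1,2} {1,2})))
     (cadd (cadd (frame {1,3} {1,3}) (cscale (1 + z * cnj z) (frame {2,4} {2,4})))
       (cadd (frame {2,3} {2,3}) (cscale (1 + z * cnj z) (frame {1,4} {1,4})))))
     (cadd (cscale (- z) (frame {1,2} {3,4})) (cscale (- cnj z) (frame {3,4} {1,2}))) I J"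
    by (simp add: Omega0_apply cadd_def)
qed

lemma Compl_4:
  "- {1,2} = {3,4::4}" "- {3,4} = {1,2::4}" "- {1,3} = {2,4::4}" "- {2,4} = {1,3::4}"
  "- {1,4} = {2,3::4}" "- {2,3} = {1,4::4}"
  by (simp_all add: set_eq_iff forall_4)

text \<open>Each monomial of \<open>Omega0\<close> selects the complementary coefficient of \<tau>.
  No signs remain: for diagonal monomials the two shuffle signs agree, and for the cross terms both
  inversion counts are 2.\<close>

lemma wedge_Omega0_UNIV:
  "wedge \<tau> (Omega0 z) UNIV UNIV =
     \<tau> {1,2} {1,2} + (1 + z * cnj z) * \<tau> {3,4} {3,4} + \<tau> {2,4} {2,4} + (1 + z * cnj z) * \<tau> {1,3} {1,3}
     + \<tau> {1,4} {1,4} + (1 + z * cnj z) * \<tau> {2,3} {2,3} - z * \<tau> {3,4} {1,2} - cnj z * \<tau> {1,2} {3,4}"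
  unfolding Omega0_frame wedge_cadd_right wedge_cscale_right
  by (simp only: cadd_def cscale_def wedge_frame_UNIV Compl_4) simp

lemma wedge_pure:
  assumes "\<alpha> \<in> Lam p 0" "\<beta> \<in> Lam 0 q"
  shows "wedge \<alpha> \<beta> I J = \<alpha> I {} * \<beta> {} J"
    "wedge \<beta> \<alpha> I J = (-1) ^ (card I * card J) * \<alpha> I {} * \<beta> {} J"
proof -
  have 0: "\<alpha> A B = 0" if "B \<noteq> {}" for A B
    using Lam_eq_0[OF assms(1), of A B] that by simp
  have 1: "\<beta> A B = 0" if "A \<noteq> {}" for A B
    using Lam_eq_0[OF assms(2), of A B] that by simp
  have "wedge \<alpha> \<beta> I J = (\<Sum>A\<in>Pow I. \<Sum>B\<in>Pow J. if B = {} then if A = I then \<alpha> I {} * \<beta> {} J else 0 else 0)"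
    unfolding wedge_def using 0 1 by (intro sum.cong refl) auto
  then show "wedge \<alpha> \<beta> I J = \<alpha> I {} * \<beta> {} J" by simp
  have "wedge \<beta> \<alpha> I J = (\<Sum>A\<in>Pow I. \<Sum>B\<in>Pow J. if B = J then if A = {} then
      (-1) ^ (card I * card J) * \<alpha> I {} * \<beta> {} J else 0 else 0)"
    unfolding wedge_def using 0 1 by (intro sum.cong refl) (auto simp: mult_ac)
  then show "wedge \<beta> \<alpha> I J = (-1) ^ (card I * card J) * \<alpha> I {} * \<beta> {} J" by simp
qed

lemma card_2_cases_4: "card I = 2 \<Longrightarrow> I \<in> {{1,2}, {1,3}, {1,4}, {2,3}, {2,4}, {3,4}}" for I :: "4 set"
  using set_4_cases[of I] by (elim insertE emptyE; hypsubst; simp)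

text \<open>The Gram determinant of the block spanned by \<open>{1,2}\<close> and \<open>{3,4}\<close> is
  \<open>(1 + \<bar>z\<bar>\<^sup>2) - \<bar>z\<bar>\<^sup>2 = 1\<close>.\<close>

lemma pure_square:
  fixes f :: "4 set \<Rightarrow> complex"
  assumes "f \<in> {f. \<exists>I. card I = 2 \<and> f I \<noteq> 0}"
    and S: "S = f {1,2} * cnj (f {1,2}) + (1 + z * cnj z) * (f {3,4} * cnj (f {3,4}))
      + f {2,4} * cnj (f {2,4}) + (1 + z * cnj z) * (f {1,3} * cnj (f {1,3}))
      + f {1,4} * cnj (f {1,4}) + (1 + z * cnj z) * (f {2,3} * cnj (f {2,3}))
      - z * (f {3,4} * cnj (f {1,2})) - cnj z * (f {1,2} * cnj (f {3,4}))"
  shows "Im S = 0 \<and> 0 < Re S"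
proof -
  let ?n = "\<lambda>x. (cmod x)\<^sup>2"
  \<comment> \<open>The square is completed in the block of \<open>{1, 2}\<close> and
    \<open>{3, 4}\<close>: of the weight \<open>1 + z * cnj z\<close> at \<open>{3, 4}\<close>, the
    part \<open>z * cnj z\<close> is absorbed and 1 is left over.\<close>
  define r where "r = ?n (f {1,2} - z * f {3,4}) + ?n (f {3,4}) + ?n (f {2,4})
     + (1 + ?n z) * ?n (f {1,3}) + ?n (f {1,4}) + (1 + ?n z) * ?n (f {2,3})"
  have "S = of_real r"
    unfolding S r_def of_real_add of_real_mult complex_norm_square of_real_1
    by (simp add: algebra_simps)
  moreover have "0 < r"
  proof -
    from assms(1) obtain I where "card I = 2" "f I \<noteq> 0" by blast
    then have "f {1,2} \<noteq> 0 \<or> f {1,3} \<noteq> 0 \<or> f {1,4} \<noteq> 0 \<or> f {2,3} \<noteq> 0 \<or> f {2,4} \<noteq> 0 \<or> f {3,4} \<noteq> 0"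
      using card_2_cases_4[of I] by blast
    then have "f {1,2} - z * f {3,4} \<noteq> 0 \<or> f {3,4} \<noteq> 0 \<or> f {2,4} \<noteq> 0 \<or> f {1,3} \<noteq> 0 \<or> f {1,4} \<noteq> 0 \<or> f {2,3} \<noteq> 0"
      by auto
    moreover have "r \<noteq> 0" if "x \<in> {f {1,2} - z * f {3,4}, f {3,4}, f {2,4}, f {1,3}, f {1,4}, f {2,3}}" "x \<noteq> 0" for x
    proof -
      have "0 \<le> ?n z * ?n y" for y by simp
      moreover have "0 < ?n x" using that by simp
      moreover have "0 \<le> ?n y" for y by simp
      ultimately show ?thesis
        using that(1) unfolding r_def distrib_right mult_1
        by (elim insertE emptyE) (smt (verit))+
    qed
    moreover have "0 \<le> r" unfolding r_def by (intro add_nonneg_nonneg mult_nonneg_nonneg) simp_all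
    ultimately show ?thesis by (smt (verit) insert_iff)
  qed
  ultimately show ?thesis by simp
qed

lemma HR_form_sign:
  assumes "Im (volume g UNIV UNIV) = 0" "0 < Re (volume g UNIV UNIV)"
    and "- (\<i> powi (int p - int q)) * wedge (wedge \<alpha> (conj_covec \<alpha>)) \<Omega> UNIV UNIV = S"
    and "Im S = 0 \<and> 0 < Re S"
  shows "Im (HR_form g \<Omega> p q \<alpha> \<alpha>) = 0 \<and> 0 < Re (HR_form g \<Omega> p q \<alpha> \<alpha>)"
proof -
  obtain v where v: "volume g UNIV UNIV = complex_of_real v" "0 < v"
    using assms(1,2) that[of "Re (volume g UNIV UNIV)"] by (simp add: complex_eq_iff)
  obtain s where s: "S = complex_of_real s" "0 < s"
    using assms(4) that[of "Re S"] by (simp add: complex_eq_iff)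
  have "HR_form g \<Omega> p q \<alpha> \<alpha> = of_real (s / v)"
    using assms(3) by (simp add: HR_form_def star_top_def v s)
  then show ?thesis using v(2) s(2) by simp
qed

text \<open>In both degrees the factor \<open>- \<i> powi (p - q)\<close> is 1, and \<alpha> wedged
  with its conjugate has coefficients \<open>f I * cnj (f J)\<close> on pairs, where
  \<open>f\<close> is conjugated in degree (0,2). This is the expression in
  \<open>pure_square\<close>.\<close>

lemma hodge_riemann_Omega0_pure:
  assumes v: "Im (volume g UNIV UNIV) = 0" "0 < Re (volume g UNIV UNIV)"
  shows "hodge_riemann_at g (omega0 z) (Omega0 z) 2 0" "hodge_riemann_at g (omega0 z) (Omega0 z) 0 2"
proof -
  show "hodge_riemann_at g (omega0 z) (Omega0 z) 2 0"
  proof (rule hodge_riemann_at_pure[OF omega0_Lam Omega0_Lam])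
    fix \<alpha> :: "4 covec" assume L: "\<alpha> \<in> Lam 2 0" "\<alpha> \<noteq> czero"
    have w: "wedge \<alpha> (conj_covec \<alpha>) I J = \<alpha> I {} * cnj (\<alpha> J {})" for I J
      using wedge_pure(1)[OF L(1) Lam_conj[OF L(1)]] by (simp add: conj_covec_def)
    have "\<exists>I. card I = 2 \<and> \<alpha> I {} \<noteq> 0"
    proof (rule ccontr)
      assume n: "\<not> ?thesis"
      have "\<alpha> I J = 0" for I J
        using n Lam_eq_0[OF L(1), of I J] by (cases "J = {}") auto
      then show False using L(2) by (simp add: czero_def fun_eq_iff)
    qed
    \<comment> \<open>The membership form lets resolution with \<open>pure_square\<close> determine
      \<open>f\<close> by first-order matching.\<close>
    then have "(\<lambda>I. \<alpha> I {}) \<in> {f. \<exists>I. card I = 2 \<and> f I \<noteq> 0}" by simp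
    then show "Im (HR_form g (Omega0 z) 2 0 \<alpha> \<alpha>) = 0 \<and> 0 < Re (HR_form g (Omega0 z) 2 0 \<alpha> \<alpha>)"
      by (rule HR_form_sign[OF v refl pure_square]) (simp add: wedge_Omega0_UNIV w)
  qed simp_all
  show "hodge_riemann_at g (omega0 z) (Omega0 z) 0 2"
  proof (rule hodge_riemann_at_pure[OF omega0_Lam Omega0_Lam])
    fix \<alpha> :: "4 covec" assume L: "\<alpha> \<in> Lam 0 2" "\<alpha> \<noteq> czero"
    have w: "wedge \<alpha> (conj_covec \<alpha>) I J = (-1) ^ (card I * card J) * (cnj (\<alpha> {} I) * \<alpha> {} J)" for I J
      using wedge_pure(2)[OF Lam_conj[OF L(1)] L(1)] by (simp add: conj_covec_def)
    have "\<exists>I. card I = 2 \<and> \<alpha> {} I \<noteq> 0"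
    proof (rule ccontr)
      assume n: "\<not> ?thesis"
      have "\<alpha> I J = 0" for I J
        using n Lam_eq_0[OF L(1), of I J] by (cases "I = {}") auto
      then show False using L(2) by (simp add: czero_def fun_eq_iff)
    qed
    then have "(\<lambda>I. cnj (\<alpha> {} I)) \<in> {f. \<exists>I. card I = 2 \<and> f I \<noteq> 0}" by simp
    then show "Im (HR_form g (Omega0 z) 0 2 \<alpha> \<alpha>) = 0 \<and> 0 < Re (HR_form g (Omega0 z) 0 2 \<alpha> \<alpha>)"
      by (rule HR_form_sign[OF v refl pure_square])
        (simp add: wedge_Omega0_UNIV w power_int_minus)
  qed simp_all
qed

section \<open>The degree (1,1)\<close>

lemma wedge_11_11:
  assumes g: "\<alpha> \<in> Lam 1 1" and h: "a < b" "d < e"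
  shows "wedge \<alpha> \<beta> {a, b} {d, e} = - (\<alpha> {a} {d} * \<beta> {b} {e} - \<alpha> {a} {e} * \<beta> {b} {d}
     - \<alpha> {b} {d} * \<beta> {a} {e} + \<alpha> {b} {e} * \<beta> {a} {d})"
proof -
  have "{a, b} - {a} = {b}" "{a, b} - {b} = {a}" "{d, e} - {d} = {e}" "{d, e} - {e} = {d}"
    "a \<noteq> b" "d \<noteq> e" "\<not> b < a" "\<not> e < d"
    using h by auto
  then show ?thesis using h
    unfolding wedge_11[OF g] by simp
qed

lemma wedge_11_Omega0_UNIV:
  assumes "\<alpha> \<in> Lam 1 1"
  shows "wedge (wedge \<alpha> \<beta>) (Omega0 z) UNIV UNIV =
    (let p = (\<lambda>a b d e. - (\<alpha> {a} {d} * \<beta> {b} {e} - \<alpha> {a} {e} * \<beta> {b} {d}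
       - \<alpha> {b} {d} * \<beta> {a} {e} + \<alpha> {b} {e} * \<beta> {a} {d}))
     in p 1 2 1 2 + (1 + z * cnj z) * p 4 3 4 3 + p 4 2 4 2 + (1 + z * cnj z) * p 1 3 1 3
     + p 4 1 4 1 + (1 + z * cnj z) * p 2 3 2 3 - z * p 4 3 1 2 - cnj z * p 1 2 4 3)"
proof -
  \<comment> \<open>Pairs containing 4 are rewritten in increasing order, so that
    \<open>wedge_11_11\<close> applies.\<close>
  have c: "{3,4} = {4,3::4}" "{2,4} = {4,2::4}" "{1,4} = {4,1::4}" by auto
  show ?thesis
    unfolding wedge_Omega0_UNIV c Let_def by (simp only: wedge_11_11[OF assms] less_4)
qed

lemma omega0_apply: "omega0 z {i} {j} = (if i = j then \<i> * weight (1 + z * cnj z) i else 0)"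
  by (simp add: omega0_def pow_diag_def diag_def)

text \<open>The sum of the diagonal entries divided by the weights of \<open>omega0\<close>, that
  is, the trace with respect to \<omega> up to a constant factor.\<close>

definition ptrace :: "complex \<Rightarrow> 4 covec \<Rightarrow> complex" where
  "ptrace z \<alpha> = \<alpha> {1} {1} + \<alpha> {2} {2} + (1 + z * cnj z) * \<alpha> {3} {3} + \<alpha> {4} {4}"

lemma wedge_omega0_Omega0_ptrace:
  assumes "\<alpha> \<in> Lam 1 1"
  shows "wedge (wedge \<alpha> (omega0 z)) (Omega0 z) UNIV UNIV = -3 * \<i> * ptrace z \<alpha>"
    "wedge (wedge (omega0 z) \<alpha>) (Omega0 z) UNIV UNIV = -3 * \<i> * ptrace z \<alpha>"
proof -
  define u where "u = 1 + z * cnj z"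
  have "u \<noteq> 0" unfolding u_def by (rule sq1_ne_0)
  then show "wedge (wedge \<alpha> (omega0 z)) (Omega0 z) UNIV UNIV = -3 * \<i> * ptrace z \<alpha>"
    "wedge (wedge (omega0 z) \<alpha>) (Omega0 z) UNIV UNIV = -3 * \<i> * ptrace z \<alpha>"
    unfolding wedge_11_Omega0_UNIV[OF assms] wedge_11_Omega0_UNIV[OF omega0_Lam] omega0_apply
      Let_def weight_def ptrace_def u_def[symmetric]
    by (simp_all add: field_simps)
qed

text \<open>The product with \<omega> and \<Omega> has type (4,4), so its vanishing is the vanishing
  of a single coefficient, a nonzero multiple of \<open>ptrace\<close>.\<close>

lemma primitive_Omega0:
  "primitive (omega0 z) (Omega0 z) 1 1 = {\<alpha> \<in> Lam 1 1. ptrace z \<alpha> = 0}"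
proof -
  have "wedge (wedge \<alpha> (omega0 z)) (Omega0 z) = czero \<longleftrightarrow> ptrace z \<alpha> = 0" if L: "\<alpha> \<in> Lam 1 1" for \<alpha>
  proof
    assume "ptrace z \<alpha> = 0"
    then have 0: "wedge (wedge \<alpha> (omega0 z)) (Omega0 z) UNIV UNIV = 0"
      by (simp add: wedge_omega0_Omega0_ptrace[OF L])
    have "wedge (wedge \<alpha> (omega0 z)) (Omega0 z) I J = 0" for I J
    proof (cases "I = UNIV \<and> J = UNIV")
      case False
      have "card A = 4 \<Longrightarrow> A = UNIV" for A :: "4 set"
        using card_eq_UNIV_imp_eq_UNIV[of A] by simp
      then have "card I \<noteq> 4 \<or> card J \<noteq> 4" using False by blast
      moreover have "(1 :: nat) + 1 + 2 = 4" by simp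
      ultimately show ?thesis
        using Lam_eq_0[OF Lam_wedge[OF Lam_wedge[OF L omega0_Lam] Omega0_Lam], of I J z z] by argo
    qed (use 0 in auto)
    then show "wedge (wedge \<alpha> (omega0 z)) (Omega0 z) = czero"
      by (simp add: fun_eq_iff czero_def)
  next
    assume "wedge (wedge \<alpha> (omega0 z)) (Omega0 z) = czero"
    then have "wedge (wedge \<alpha> (omega0 z)) (Omega0 z) UNIV UNIV = 0" by (simp add: czero_def)
    then show "ptrace z \<alpha> = 0" by (simp add: wedge_omega0_Omega0_ptrace[OF L])
  qed
  then show ?thesis by (auto simp: primitive_def)
qed

lemma lefschetz_image_11:
  assumes "\<omega> \<in> Lam 1 1"
  shows "lefschetz_image \<omega> 1 1 = range (\<lambda>c. cscale c \<omega>)"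
proof -
  have w: "wedge \<omega> cone = \<omega>"
  proof (intro ext)
    fix I J
    have e: "A - {a} = {} \<and> a \<in> A \<longleftrightarrow> A = {a}" for a :: 'a and A by auto
    show "wedge \<omega> cone I J = \<omega> I J"
    proof (cases "\<exists>i j. I = {i} \<and> J = {j}")
      case True
      then show ?thesis by (auto simp: wedge_11[OF assms] cone_def)
    next
      case False
      then have "\<omega> I J = 0"
        using Lam_eq_0[OF assms, of I J] by (metis card_1_singletonE)
      moreover have "cone (I - {i}) (J - {j}) = 0" if "i \<in> I" "j \<in> J" for i j
        using False e[of I i] e[of J j] that by (auto simp: cone_def)
      ultimately show ?thesis
        by (simp add: wedge_11[OF assms])
    qed
  qed
  have L: "Lam 0 0 = range (\<lambda>c. cscale c (cone :: 'a covec))"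
  proof
    show "Lam 0 0 \<subseteq> range (\<lambda>c. cscale c (cone :: 'a covec))"
    proof
      fix \<alpha> :: "'a covec" assume "\<alpha> \<in> Lam 0 0"
      then have "\<alpha> I J = 0" if "I \<noteq> {} \<or> J \<noteq> {}" for I J
        using Lam_eq_0[of \<alpha> 0 0 I J] that by auto
      then have "\<alpha> = cscale (\<alpha> {} {}) cone"
        by (auto simp: cscale_def cone_def fun_eq_iff)
      then show "\<alpha> \<in> range (\<lambda>c. cscale c cone)" by blast
    qed
  qed (auto simp: Lam_def cscale_def cone_def split: if_splits)
  have "wedge \<omega> ` Lam 0 0 = range (\<lambda>c. cscale c \<omega>)"
    unfolding L image_image wedge_cscale_right w ..
  then show ?thesis by (simp add: lefschetz_image_def)
qed

lemma ptrace_lin: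
  "ptrace z (cscale c \<alpha>) = c * ptrace z \<alpha>"
  "ptrace z (cadd \<alpha> \<beta>) = ptrace z \<alpha> + ptrace z \<beta>"
  "ptrace z (omega0 z) = 4 * \<i>"
  "ptrace z (conj_covec \<alpha>) = - cnj (ptrace z \<alpha>)"
proof -
  define u where "u = 1 + z * cnj z"
  have "u \<noteq> 0" unfolding u_def by (rule sq1_ne_0)
  then show "ptrace z (omega0 z) = 4 * \<i>"
    unfolding ptrace_def omega0_apply weight_def u_def[symmetric] by simp
qed (simp_all add: ptrace_def cscale_def cadd_def conj_covec_def algebra_simps)

text \<open>Since the weighted trace of \<open>\<alpha>\<close> vanishes, the diagonal entries contribute the sum of their
  weighted squares; the off-diagonal ones pair up to Gram blocks of determinant \<open>1\<close>.\<close>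

lemma primitive_11_square:
  fixes a :: "4 \<Rightarrow> 4 \<Rightarrow> complex"
  assumes tr: "a 4 4 = - (a 1 1 + a 2 2 + (1 + z * cnj z) * a 3 3)"
    and S: "S = (let p = (\<lambda>i j k l. a i k * cnj (a l j) - a i l * cnj (a k j)
        - a j k * cnj (a l i) + a j l * cnj (a k i))
     in - (p 1 2 1 2 + (1 + z * cnj z) * p 4 3 4 3 + p 4 2 4 2 + (1 + z * cnj z) * p 1 3 1 3
     + p 4 1 4 1 + (1 + z * cnj z) * p 2 3 2 3 - z * p 4 3 1 2 - cnj z * p 1 2 4 3))"
    and nz: "a i j \<noteq> 0"
  shows "Im S = 0 \<and> 0 < Re S"
proof -
  let ?n = "\<lambda>x. (cmod x)\<^sup>2"
  let ?u = "1 + z * cnj z" and ?r = "1 + ?n z"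
  \<comment> \<open>The numbers \<open>a 1 1\<close>, \<open>a 2 2\<close>,
    \<open>?u * a 3 3\<close>, \<open>a 4 4\<close> sum to zero, so minus their mixed products gives
    the sum of their squared moduli. The cross term couples \<open>a 1 4\<close> with
    \<open>a 3 2\<close>, \<open>a 4 1\<close> with \<open>a 2 3\<close>, \<open>a 4 2\<close> with
    \<open>a 1 3\<close> and \<open>a 2 4\<close> with \<open>a 3 1\<close>; in each pair the square
    is completed.\<close>
  define r where "r = ?n (a 1 1) + ?n (a 2 2) + ?n (?u * a 3 3) + ?n (a 4 4)
    + ?n (a 1 2) + ?n (a 2 1) + ?r * ?n (a 3 4) + ?r * ?n (a 4 3)
    + ?n (a 1 4 + z * a 3 2) + ?n (a 3 2) + ?n (a 4 1 + cnj z * a 2 3) + ?n (a 2 3)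
    + ?n (a 4 2 - cnj z * a 1 3) + ?n (a 1 3) + ?n (a 2 4 - z * a 3 1) + ?n (a 3 1)"
  have "S = of_real r"
    unfolding S r_def tr Let_def of_real_add of_real_mult complex_norm_square of_real_1
    by (simp add: algebra_simps)
  moreover have "0 < r"
  proof -
    have "0 \<le> r" unfolding r_def by (intro add_nonneg_nonneg mult_nonneg_nonneg) simp_all
    moreover have "r \<noteq> 0"
    proof
      assume "r = 0"
      have nn: "0 \<le> ?n x" "0 \<le> ?r * ?n x" for x by simp_all
      have "?n (a 1 1) = 0 \<and> ?n (a 2 2) = 0 \<and> ?n (?u * a 3 3) = 0 \<and> ?n (a 4 4) = 0 \<and>
        ?n (a 1 2) = 0 \<and> ?n (a 2 1) = 0 \<and> ?r * ?n (a 3 4) = 0 \<and> ?r * ?n (a 4 3) = 0 \<and>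
        ?n (a 1 4 + z * a 3 2) = 0 \<and> ?n (a 3 2) = 0 \<and> ?n (a 4 1 + cnj z * a 2 3) = 0 \<and> ?n (a 2 3) = 0 \<and>
        ?n (a 4 2 - cnj z * a 1 3) = 0 \<and> ?n (a 1 3) = 0 \<and> ?n (a 2 4 - z * a 3 1) = 0 \<and> ?n (a 3 1) = 0"
        using \<open>r = 0\<close>[unfolded r_def] nn by (simp only: add_nonneg_eq_0_iff add_nonneg_nonneg)
      moreover have "?r \<noteq> 0" using sq1_pos[of z] unfolding sq1_def by linarith
      ultimately have "a 1 1 = 0" "a 2 2 = 0" "a 3 3 = 0" "a 4 4 = 0" "a 1 2 = 0" "a 2 1 = 0"
        "a 3 4 = 0" "a 4 3 = 0" "a 1 4 = 0" "a 3 2 = 0" "a 4 1 = 0" "a 2 3 = 0" "a 4 2 = 0"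
        "a 1 3 = 0" "a 2 4 = 0" "a 3 1 = 0"
        using sq1_ne_0[of z] by auto
      then show False
        using nz exhaust_4[of i] exhaust_4[of j] by (elim disjE) simp_all
    qed
    ultimately show ?thesis by linarith
  qed
  ultimately show ?thesis by simp
qed

lemma hodge_riemann_Omega0_11:
  assumes v: "Im (volume g UNIV UNIV) = 0" "0 < Re (volume g UNIV UNIV)"
  shows "hodge_riemann_at g (omega0 z) (Omega0 z) 1 1"
  unfolding hodge_riemann_at_def primitive_Omega0 lefschetz_image_11[OF omega0_Lam]
proof (intro conjI ballI impI)
  fix \<alpha> assume a: "\<alpha> \<in> {\<alpha> \<in> Lam 1 1. ptrace z \<alpha> = 0}" "\<alpha> \<noteq> czero"
  then have L: "\<alpha> \<in> Lam 1 1" and t: "ptrace z \<alpha> = 0" by auto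
  obtain i j where ij: "\<alpha> {i} {j} \<noteq> 0"
  proof -
    from a(2) obtain I J where "\<alpha> I J \<noteq> 0" by (auto simp: czero_def fun_eq_iff)
    moreover from this have "card I = 1 \<and> card J = 1" using L by (auto simp: Lam_def)
    ultimately show ?thesis using that by (auto simp: card_1_singleton_iff)
  qed
  have t': "\<alpha> {4} {4} = - (\<alpha> {1} {1} + \<alpha> {2} {2} + (1 + z * cnj z) * \<alpha> {3} {3})"
    by (rule minus_unique[symmetric]) (rule t[unfolded ptrace_def])
  \<comment> \<open>The minus sign of \<open>wedge_11_11\<close> cancels the one that conjugation
    puts on (1,1)-coefficients; what remains is the minus sign of the form
    \<open>HR_form\<close>.\<close>
  have "Im (HR_form g (Omega0 z) 1 1 \<alpha> \<alpha>) = 0 \<and> 0 < Re (HR_form g (Omega0 z) 1 1 \<alpha> \<alpha>)"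
    by (rule HR_form_sign[OF v refl primitive_11_square[where a = "\<lambda>i j. \<alpha> {i} {j}", OF t' _ ij]])
      (simp add: wedge_11_Omega0_UNIV[OF L] Let_def conj_covec_def algebra_simps)
  then show "Im (HR_form g (Omega0 z) 1 1 \<alpha> \<alpha>) = 0" "0 < Re (HR_form g (Omega0 z) 1 1 \<alpha> \<alpha>)"
    by blast+
next
  let ?D = "{cadd \<eta> \<rho> |\<eta> \<rho>. \<eta> \<in> range (\<lambda>c. cscale c (omega0 z)) \<and> \<rho> \<in> {\<alpha> \<in> Lam 1 1. ptrace z \<alpha> = 0}}"
  have sc: "cscale c \<alpha> \<in> Lam 1 1" if "\<alpha> \<in> Lam 1 1" for c and \<alpha> :: "4 covec"
    using that by (auto simp: Lam_def cscale_def)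
  show "Lam 1 1 = ?D"
  proof
    show "Lam 1 1 \<subseteq> ?D"
    proof
      fix \<alpha> :: "4 covec" assume L: "\<alpha> \<in> Lam 1 1"
      \<comment> \<open>As \<open>omega0 z\<close> has trace \<open>4 * \<i>\<close>, subtracting
        this multiple of it makes \<alpha> traceless.\<close>
      define c where "c = ptrace z \<alpha> / (4 * \<i>)"
      let ?\<rho> = "cadd \<alpha> (cscale (- c) (omega0 z))"
      have "?\<rho> \<in> Lam 1 1" by (intro Lam_cadd L sc omega0_Lam)
      moreover have "ptrace z ?\<rho> = 0"
      proof -
        have "c * (4 * \<i>) = ptrace z \<alpha>" unfolding c_def by (rule nonzero_eq_divide_eq[THEN iffD1]) simp_all
        then show ?thesis unfolding ptrace_lin by (simp only: mult_minus_left add.right_inverse)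
      qed
      moreover have "\<alpha> = cadd (cscale c (omega0 z)) ?\<rho>"
        by (simp add: cadd_def cscale_def fun_eq_iff)
      ultimately show "\<alpha> \<in> ?D" by blast
    qed
    show "?D \<subseteq> Lam 1 1" using Lam_cadd sc omega0_Lam by blast
  qed
  have "cscale c (omega0 z) = czero" if "ptrace z (cscale c (omega0 z)) = 0" for c
    using that unfolding ptrace_lin by (simp add: cscale_def czero_def)
  moreover have "czero = cscale 0 (omega0 z)" "ptrace z czero = 0"
    by (simp_all add: cscale_def czero_def ptrace_def)
  ultimately show "range (\<lambda>c. cscale c (omega0 z)) \<inter> {\<alpha> \<in> Lam 1 1. ptrace z \<alpha> = 0} = {czero}"
    by (auto simp del: One_nat_def)
  fix \<eta> \<rho> assume "\<eta> \<in> range (\<lambda>c. cscale c (omega0 z))" and r: "\<rho> \<in> {\<alpha> \<in> Lam 1 1. ptrace z \<alpha> = 0}"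
  then obtain c where c: "\<eta> = cscale c (omega0 z)" by blast
  \<comment> \<open>Conjugation preserves tracelessness, so the pairing with \<open>omega0 z\<close>
    vanishes.\<close>
  have "wedge (wedge (omega0 z) (conj_covec \<rho>)) (Omega0 z) UNIV UNIV = 0"
    using r by (simp add: wedge_omega0_Omega0_ptrace(2)[OF Lam_conj] ptrace_lin del: One_nat_def)
  then show "HR_form g (Omega0 z) 1 1 \<eta> \<rho> = 0"
    unfolding HR_form_def star_top_def c wedge_cscale_left by (simp add: cscale_def)
qed

section \<open>The balanced metric\<close>

lemma left_translation_translate_4:
  "A \<in> heis UNIV \<Longrightarrow> left_translation (A, c) = translate_4 (A $ 1 $ 2) (A $ 2 $ 3) (A $ 1 $ 3) c"
  by (simp add: fun_eq_iff left_translation_eq translate_4_def)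

lemma Ck_if: "Ck k f \<Longrightarrow> Ck k (\<lambda>x. if P then f x else 0)"
  using Ck_const by (cases P) auto

text \<open>Elements of the lattice act trivially on \<open>z_4\<close>, the only variable on which
  the coefficients in the invariant frame depend.\<close>

lemma form_on_sheared_form:
  assumes "\<And>k I J. Ck k (\<lambda>x :: 4 cspace. A (x $ 4) I J)"
  shows "form_on iwasawa_C (sheared_form A)"
  unfolding form_on_def
proof
  have 1: "Ck k (\<lambda>x :: 4 cspace. - x $ 1)" "Ck k (\<lambda>x :: 4 cspace. - cnj (x $ 1))" for k
    using Ck_mult[OF Ck_const[of k "-1"] Ck_coord(1)[of k 1]]
      Ck_mult[OF Ck_const[of k "-1"] Ck_coord(2)[of k 1]] by simp_all
  show "smooth_form (sheared_form A)"
    unfolding smooth_form_def sheared_form_def shear_apply complex_cnj_minus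
    by (intro allI Ck_add Ck_mult Ck_if Ck_const 1 assms)
  show "\<forall>\<gamma>\<in>iwasawa_C. pullback \<gamma> (sheared_form A) = sheared_form A"
  proof
    fix \<gamma> assume "\<gamma> \<in> iwasawa_C"
    then obtain B where B: "\<gamma> = left_translation (B, 0)" "B \<in> heis gaussian_ints"
      by (auto simp: iwasawa_C_def)
    then have "B \<in> heis UNIV" by (auto simp: heis_def)
    then show "pullback \<gamma> (sheared_form A) = sheared_form A"
      by (simp add: B(1) left_translation_translate_4 fun_eq_iff pullback_sheared_form)
         (simp add: sheared_form_def)
  qed
qed

lemma Ck_omega0: "Ck k (\<lambda>x :: 4 cspace. omega0 (x $ 4) I J)"
proof -
  have e: "omega0 z I J = (if I = J \<and> card I = 1 \<and> 3 \<in> I then \<i> * of_real (sq1 z powr (-1)) else 0)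
      + (if I = J \<and> card I = 1 \<and> 3 \<notin> I then \<i> else 0)" for z
    by (simp add: omega0_def pow_diag_def diag_def prod_weight powr_minus_divide of_real_sq1 abs_of_pos[OF sq1_pos])
  show ?thesis
    unfolding e by (intro Ck_add Ck_if Ck_mult Ck_const Ck_sq1_powr)
qed

lemma Ck_Omega0: "Ck k (\<lambda>x :: 4 cspace. Omega0 (x $ 4) I J)"
proof -
  have e: "Omega0 z I J = (if I = J \<and> card I = 2 \<and> 3 \<in> I then 1 else 0)
      + (if I = J \<and> card I = 2 \<and> 3 \<notin> I then of_real (sq1 z powr 1) else 0)
      + (if I = {1, 2} \<and> J = {3, 4} then (-1) * z else 0)
      + (if I = {3, 4} \<and> J = {1, 2} then (-1) * cnj z else 0)" for z
  proof -
    have "cross z I J = (if I = {1, 2} \<and> J = {3, 4} then (-1) * z else 0)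
      + (if I = {3, 4} \<and> J = {1, 2} then (-1) * cnj z else 0)"
      by (cases "I = {1, 2} \<and> J = {3, 4}"; cases "I = {3, 4} \<and> J = {1, 2}")
        (auto simp: cross_def set_4_neq)
    moreover have "complex_of_real (sq1 z powr 1) = 1 + z * cnj z"
      by (simp add: of_real_sq1 abs_of_pos[OF sq1_pos])
    ultimately show ?thesis
      unfolding Omega0_apply by (cases "I = J \<and> card I = 2"; cases "3 \<in> I") (simp_all only: simp_thms if_True if_False add_0 add_0_right add.assoc)
  qed
  show ?thesis
    unfolding e by (intro Ck_add Ck_if Ck_mult Ck_const Ck_sq1_powr Ck_coord)
qed

text \<open>The conformal factor from \<omega> to \<open>F\<close>, chosen so that its cube is
  \<open>3 * u\<close>: the cube of \<open>F\<close> divided by 3! must be \<open>u / 2\<close>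
  times the cube of \<omega>.\<close>

definition conf :: "complex \<Rightarrow> real" where
  "conf z = 3 powr (1 / 3) * sq1 z powr (1 / 3)"

lemma conf_cube: "conf z ^ 3 = 3 * sq1 z"
proof -
  have "(x powr (1 / 3)) ^ 3 = x" if "0 < x" for x :: real
    using that by (simp add: powr_power)
  then show ?thesis by (simp add: conf_def power_mult_distrib)
qed

lemma conf_pos: "0 < conf z"
  by (simp add: conf_def less_imp_neq[symmetric])

lemma hermitian_sheared_form_omega0:
  assumes c: "\<And>k. Ck k (\<lambda>x :: 4 cspace. complex_of_real (c (x $ 4)))" and pos: "\<And>z. 0 < c z"
  shows "hermitian_metric_on iwasawa_C (sheared_form (\<lambda>z. cscale (of_real (c z)) (omega0 z)))"
  unfolding hermitian_metric_on_def
proof (intro conjI)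
  let ?F = "sheared_form (\<lambda>z. cscale (of_real (c z)) (omega0 z))"
  show "form_on iwasawa_C ?F"
    by (rule form_on_sheared_form) (simp add: cscale_def Ck_mult c Ck_omega0)
  have "cscale a (omega0 z) \<in> Lam 1 1" for a z
    using omega0_Lam[of z] by (auto simp: Lam_def cscale_def)
  then show "has_type 1 1 ?F"
    unfolding has_type_def sheared_form_def by (blast intro: shear_Lam)
  have "conj_covec (cscale a \<alpha>) = cscale (cnj a) (conj_covec \<alpha>)" for a and \<alpha> :: "4 covec"
    by (simp add: conj_covec_def cscale_def mult_ac)
  then show "real_form ?F"
    by (simp add: real_form_def sheared_form_def conj_shear conj_omega0)
  show "positive_11 ?F"
    unfolding positive_11_def
  proof (intro allI impI)
    fix x v :: "4 cspace" assume v: "v \<noteq> 0"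
    let ?n = "\<lambda>y. (cmod y)\<^sup>2" and ?t = "- x $ 1"
    define r where "r = 1 / sq1 (x $ 4)"
    have r: "1 / (1 + x $ 4 * cnj (x $ 4)) = of_real r"
      by (simp add: r_def of_real_sq1)
    \<comment> \<open>The Hermitian form is diagonal in the values \<open>\<phi>_j(v)\<close>; the
      one for \<open>j = 3\<close> is \<open>v $ 3 - x $ 1 * v $ 2\<close>.\<close>
    have "(\<Sum>j\<in>UNIV. \<Sum>k\<in>UNIV. - \<i> * ?F x {j} {k} * v $ j * cnj (v $ k))
      = of_real (c (x $ 4) * (?n (v $ 1) + ?n (v $ 2) + ?n (v $ 4) + r * ?n (v $ 3 + ?t * v $ 2)))"
      unfolding sum_4 sheared_form_def shear_apply cscale_def of_real_add of_real_mult complex_norm_square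
      by (simp add: omega0_apply weight_def r algebra_simps)
    moreover have "0 < ?n (v $ 1) + ?n (v $ 2) + ?n (v $ 4) + r * ?n (v $ 3 + ?t * v $ 2)" (is "0 < ?s")
    proof -
      have rp: "0 < r" by (simp add: r_def)
      have "v $ 1 \<noteq> 0 \<or> v $ 2 \<noteq> 0 \<or> v $ 4 \<noteq> 0 \<or> v $ 3 + ?t * v $ 2 \<noteq> 0"
        using v by (auto simp: vec_eq_iff forall_4)
      then have "0 < ?n (v $ 1) \<or> 0 < ?n (v $ 2) \<or> 0 < ?n (v $ 4) \<or> 0 < r * ?n (v $ 3 + ?t * v $ 2)"
        using rp by auto
      moreover have "0 \<le> r * ?n (v $ 3 + ?t * v $ 2)" using rp by simp
      moreover have "0 \<le> ?n y" for y by simp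
      ultimately show ?thesis by (smt (verit))
    qed
    ultimately show "0 < Re (\<Sum>j\<in>UNIV. \<Sum>k\<in>UNIV. - \<i> * ?F x {j} {k} * v $ j * cnj (v $ k))"
      using pos[of "x $ 4"] by (simp only: Re_complex_of_real mult_pos_pos)
  qed
qed

text \<open>The constant 18 is 3 from the cubed conformal factor times 6 from
  \<open>wedge_power_omega0\<close>. Division by 3! leaves the 3 of
  \<open>wedge_omega0_Omega0\<close>.\<close>

lemma wedge_power_sheared_form_conf:
  "wedge_power (sheared_form (\<lambda>z. cscale (of_real (conf z)) (omega0 z)) x) 3 =
     sheared_form (\<lambda>z. pow_diag 3 (18 * \<i> * (1 + z * cnj z)) (weight (1 + z * cnj z))) x"
proof -
  have "complex_of_real (conf z) ^ 3 = 3 * (1 + z * cnj z)" for z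
    using arg_cong[OF conf_cube[of z], of complex_of_real]
    unfolding of_real_mult of_real_power of_real_sq1 by simp
  then show ?thesis
    by (simp add: sheared_form_def wedge_power_shear wedge_power_cscale wedge_power_omega0 cscale_pow_diag
        mult_ac)
qed

theorem theorem3:
  fixes g :: "4 cform"
  assumes "hermitian_metric_on iwasawa_C g"
  shows "\<exists>F. balanced_HR_type_on iwasawa_C g F \<and> \<not> invariant_metric F"
proof (intro exI conjI)
  let ?F = "sheared_form (\<lambda>z. cscale (of_real (conf z)) (omega0 z))"
  let ?\<omega> = "sheared_form omega0" and ?\<Omega> = "sheared_form Omega0"
  let ?W = "sheared_form (\<lambda>z. pow_diag 3 (3 * \<i> * (1 + z * cnj z)) (weight (1 + z * cnj z)))"
  have card: "CARD(4) - 1 = 3" "CARD(4) - 2 = 2" by simp_all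
  have "Ck k (\<lambda>x :: 4 cspace. complex_of_real (conf (x $ 4)))" for k
    unfolding conf_def of_real_mult by (intro Ck_mult Ck_const Ck_sq1_powr)
  then have F: "hermitian_metric_on iwasawa_C ?F"
    by (rule hermitian_sheared_form_omega0[OF _ conf_pos])
  have \<omega>: "hermitian_metric_on iwasawa_C ?\<omega>"
    using hermitian_sheared_form_omega0[of "\<lambda>_. 1"] by (simp add: Ck_const cscale_def)
  have W: "wedge (?\<omega> x) (?\<Omega> x) = ?W x" for x
    by (simp add: sheared_form_def wedge_omega0_Omega0 flip: shear_wedge)
  have F3: "cscale (1 / fact 3) (wedge_power (?F x) 3) = ?W x" for x
    unfolding wedge_power_sheared_form_conf unfolding sheared_form_def
    by (simp add: cscale_pow_diag fact_numeral mult.assoc flip: shear_cscale)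
  have HR: "hodge_riemann_at (g x) (?\<omega> x) (?\<Omega> x) p q" if "p + q = 2" for p q x
  proof -
    have "p = 2 \<and> q = 0 \<or> p = 1 \<and> q = 1 \<or> p = 0 \<and> q = 2" using that by presburger
    then show ?thesis
      unfolding sheared_form_def
      using hodge_riemann_Omega0_pure[OF volume_pos[OF assms], of x]
        hodge_riemann_Omega0_11[OF volume_pos[OF assms], of x]
      by (intro hodge_riemann_at_shear) blast
  qed
  show "balanced_HR_type_on iwasawa_C g ?F"
    unfolding balanced_HR_type_on_def balanced_metric_on_def card
  proof (rule conjI, rule conjI[OF F], goal_cases)
    case 1
    show ?case
      unfolding wedge_power_sheared_form_conf by (rule closed_left_inv_pow_diag_3)
  next
    case 2
    show ?case
    proof (rule exI[of _ ?\<omega>], rule exI[of _ ?\<Omega>], intro conjI)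
      show "form_on iwasawa_C ?\<Omega>"
        by (rule form_on_sheared_form[OF Ck_Omega0])
      show "has_type 2 2 ?\<Omega>"
        unfolding has_type_def sheared_form_def by (blast intro: shear_Lam Omega0_Lam)
      show "real_form ?\<Omega>"
        by (simp add: real_form_def sheared_form_def conj_shear conj_Omega0)
      show "closed_form (\<lambda>x. wedge (?\<omega> x) (?\<Omega> x))"
        unfolding W by (rule closed_left_inv_pow_diag_3)
    qed (use \<omega> W F3 HR closed_left_inv_Omega0 in auto)
  qed
  show "\<not> invariant_metric ?F"
  proof
    assume "invariant_metric ?F"
    moreover have 1: "mat 1 \<in> heis UNIV"
      by (simp add: heis_def mat_def)
    ultimately have "pullback (left_translation (mat 1, 1)) ?F = ?F"
      unfolding invariant_metric_def by blast
    \<comment> \<open>At the origin the shear is trivial and this coefficient is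
      \<open>\<i> * conf\<close>. Invariance under the unit translation of \<open>z_4\<close> would
      equate the values of \<open>sq1\<close> at 1 and 0, which are 2 and 1.\<close>
    then have "pullback (left_translation (mat 1, 1)) ?F 0 {1} {1} = ?F 0 {1} {1}" by simp
    then have "conf 1 = conf 0"
      by (simp add: left_translation_translate_4[OF 1] pullback_sheared_form)
         (simp add: sheared_form_def cscale_def omega0_apply weight_def)
    then have "3 * sq1 1 = 3 * sq1 0" by (simp flip: conf_cube)
    then show False by (simp add: sq1_def)
  qed
qed

end
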